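(* There is a unique $\mathbb{G}_a^1$-structure on $\mathbb{P}^1$, up to equivalence.
   Context: The base field is $F=\overline{\mathbb{Q}}$. For a connected linear algebraic group $\mathbb{G}$, a $\mathbb{G}$-variety is a variety $X$ with a fixed left $\mathbb{G}$-action such that the stabilizer of a generic point is trivial and the orbit of a generic point is dense. A $\mathbb{G}$-structure on a variety $Y$ is a $\mathbb{G}$-action making $Y$ a $\mathbb{G}$-variety. Two $\mathbb{G}$-varieties $X_1,X_2$ are equivalent if there are $\alpha\in\mathrm{Aut}(\mathbb{G})$ and an isomorphism of varieties $j:X_1\to X_2$ with $j(g\cdot x)=\alpha(g)\cdot j(x)$. *)

theory Defs
  imports
    "HOL-Analysis.Abstract_Topology"
    "HOL-Algebra.Group_Action"
    "HOL-Algebra.Algebraic_Closure_Type"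
begin

section \<open>Spaces with functions\<close>

text \<open>
  Varieties over an algebraically closed field \<open>k\<close> are treated classically (as in Kempf's
  \<^emph>\<open>Algebraic Varieties\<close> or Springer's \<^emph>\<open>Linear Algebraic Groups\<close>): a topological space of closed
  points together with a sheaf of \<open>k\<close>-valued functions. As functions are total in HOL,
  \<open>regular S U f\<close> says that the restriction of \<open>f\<close> to the open set \<open>U\<close> is regular; the values of
  \<open>f\<close> outside \<open>U\<close> are irrelevant.
\<close>

record ('a, 'k) function_space =
  zariski :: "'a topology"
  regular :: "'a set \<Rightarrow> ('a \<Rightarrow> 'k) \<Rightarrow> bool"

abbreviation points :: "('a, 'k) function_space \<Rightarrow> 'a set" where
  "points S \<equiv> topspace (zariski S)"

locale space_with_functions =
  fixes S :: "('a, 'k :: field) function_space"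
  assumes regular_open: "regular S U f \<Longrightarrow> openin (zariski S) U"
    and regular_cong: "\<lbrakk>regular S U f; \<And>x. x \<in> U \<Longrightarrow> g x = f x\<rbrakk> \<Longrightarrow> regular S U g"
    and regular_const: "openin (zariski S) U \<Longrightarrow> regular S U (\<lambda>_. c)"
    and regular_add: "\<lbrakk>regular S U f; regular S U g\<rbrakk> \<Longrightarrow> regular S U (\<lambda>x. f x + g x)"
    and regular_mult: "\<lbrakk>regular S U f; regular S U g\<rbrakk> \<Longrightarrow> regular S U (\<lambda>x. f x * g x)"
    and regular_sheaf: "(\<And>U. U \<in> \<U> \<Longrightarrow> openin (zariski S) U) \<Longrightarrow>
          regular S (\<Union>\<U>) f \<longleftrightarrow> (\<forall>U\<in>\<U>. regular S U f)"
    and nonvanishing_open: "regular S U f \<Longrightarrow> openin (zariski S) {x \<in> U. f x \<noteq> 0}"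
    and regular_inverse: "regular S U f \<Longrightarrow> regular S {x \<in> U. f x \<noteq> 0} (\<lambda>x. inverse (f x))"

definition morphism ::
  "('a, 'k) function_space \<Rightarrow> ('b, 'k) function_space \<Rightarrow> ('a \<Rightarrow> 'b) \<Rightarrow> bool" where
  "morphism S T h \<longleftrightarrow> continuous_map (zariski S) (zariski T) h \<and>
     (\<forall>V f. regular T V f \<longrightarrow> regular S {x \<in> points S. h x \<in> V} (f \<circ> h))"

definition isomorphism ::
  "('a, 'k) function_space \<Rightarrow> ('b, 'k) function_space \<Rightarrow> ('a \<Rightarrow> 'b) \<Rightarrow> bool" where
  "isomorphism S T h \<longleftrightarrow> morphism S T h \<and>
     (\<exists>h'. morphism T S h' \<and> (\<forall>x\<in>points S. h' (h x) = x) \<and> (\<forall>y\<in>points T. h (h' y) = y))"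

text \<open>Induced structure on a subset: regular functions are locally restrictions of regular
  functions of \<open>S\<close>. It is used for open subsets and for closed subsets.\<close>

definition induced_space ::
  "('a, 'k) function_space \<Rightarrow> 'a set \<Rightarrow> ('a, 'k) function_space" where
  "induced_space S Z =
     \<lparr>zariski = subtopology (zariski S) Z,
      regular = (\<lambda>U f. openin (subtopology (zariski S) Z) U \<and>
        (\<forall>x\<in>U. \<exists>V g. x \<in> V \<and> V \<inter> Z \<subseteq> U \<and> regular S V g \<and> (\<forall>y\<in>V \<inter> Z. f y = g y)))\<rparr>"

text \<open>The categorical product of spaces with functions. The sets \<^term>\<open>tensor_nonzero U V n f g\<close> with
  \<open>f i\<close> regular on \<open>U\<close> and \<open>g i\<close> regular on \<open>V\<close> form a basis of its topology; its regular functions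
  are locally quotients of sums \<open>\<Sum>i<n. f i \<otimes> g i\<close>.\<close>

definition tensor_sum ::
  "nat \<Rightarrow> (nat \<Rightarrow> 'a \<Rightarrow> 'k :: field) \<Rightarrow> (nat \<Rightarrow> 'b \<Rightarrow> 'k) \<Rightarrow> 'a \<times> 'b \<Rightarrow> 'k" where
  "tensor_sum n f g = (\<lambda>(x, y). \<Sum>i<n. f i x * g i y)"

definition tensor_nonzero ::
  "'a set \<Rightarrow> 'b set \<Rightarrow> nat \<Rightarrow> (nat \<Rightarrow> 'a \<Rightarrow> 'k :: field) \<Rightarrow> (nat \<Rightarrow> 'b \<Rightarrow> 'k) \<Rightarrow> ('a \<times> 'b) set" where
  "tensor_nonzero U V n f g = {p \<in> U \<times> V. tensor_sum n f g p \<noteq> 0}"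

definition product_topology_basis ::
  "('a, 'k :: field) function_space \<Rightarrow> ('b, 'k) function_space \<Rightarrow> ('a \<times> 'b) set set" where
  "product_topology_basis S T =
     {tensor_nonzero U V n f g | U V n f g.
        openin (zariski S) U \<and> openin (zariski T) V \<and>
        (\<forall>i<n. regular S U (f i) \<and> regular T V (g i))}"

definition product_space ::
  "('a, 'k :: field) function_space \<Rightarrow> ('b, 'k) function_space \<Rightarrow> ('a \<times> 'b, 'k) function_space" where
  "product_space S T =
     \<lparr>zariski = topology_generated_by (product_topology_basis S T),
      regular = (\<lambda>W h. openin (topology_generated_by (product_topology_basis S T)) W \<and>
        (\<forall>p\<in>W. \<exists>U V m a b n c d.
           openin (zariski S) U \<and> openin (zariski T) V \<and>
           (\<forall>i<m. regular S U (a i) \<and> regular T V (b i)) \<and>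
           (\<forall>i<n. regular S U (c i) \<and> regular T V (d i)) \<and>
           p \<in> tensor_nonzero U V n c d \<and> tensor_nonzero U V n c d \<subseteq> W \<and>
           (\<forall>q\<in>tensor_nonzero U V n c d. h q = tensor_sum m a b q / tensor_sum n c d q)))\<rparr>"


section \<open>Affine and projective space\<close>

text \<open>Points of \<open>k\<^sup>n\<close> are sequences vanishing from index \<open>n\<close> on.\<close>

definition coordinate_space :: "nat \<Rightarrow> (nat \<Rightarrow> 'k :: field) set" where
  "coordinate_space n = {x. \<forall>i\<ge>n. x i = 0}"

definition polynomial_function :: "nat \<Rightarrow> ((nat \<Rightarrow> 'k :: field) \<Rightarrow> 'k) \<Rightarrow> bool" where
  "polynomial_function n p \<longleftrightarrow>
     (\<exists>M c. finite M \<and> p = (\<lambda>x. \<Sum>m\<in>M. c m * (\<Prod>i<n. x i ^ m i)))"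

definition homogeneous_form :: "nat \<Rightarrow> nat \<Rightarrow> ((nat \<Rightarrow> 'k :: field) \<Rightarrow> 'k) \<Rightarrow> bool" where
  "homogeneous_form n d p \<longleftrightarrow>
     (\<exists>M c. finite M \<and> (\<forall>m\<in>M. (\<Sum>i<n. m i) = d) \<and>
        p = (\<lambda>x. \<Sum>m\<in>M. c m * (\<Prod>i<n. x i ^ m i)))"

definition affine_topology :: "nat \<Rightarrow> (nat \<Rightarrow> 'k :: field) topology" where
  "affine_topology n =
     topology_generated_by {{x \<in> coordinate_space n. p x \<noteq> 0} | p. polynomial_function n p}"

definition affine_space :: "nat \<Rightarrow> (nat \<Rightarrow> 'k :: alg_closed_field, 'k) function_space" where
  "affine_space n =
     \<lparr>zariski = affine_topology n,
      regular = (\<lambda>U f. openin (affine_topology n) U \<and>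
        (\<forall>x\<in>U. \<exists>V p q. openin (affine_topology n) V \<and> x \<in> V \<and> V \<subseteq> U \<and>
           polynomial_function n p \<and> polynomial_function n q \<and>
           (\<forall>y\<in>V. q y \<noteq> 0 \<and> f y = p y / q y)))\<rparr>"

text \<open>Points of \<open>P\<^sup>n\<close> are the lines through the origin in \<open>k\<^sup>n\<^sup>+\<^sup>1\<close>, as sets of vectors.\<close>

definition projective_points :: "nat \<Rightarrow> (nat \<Rightarrow> 'k :: field) set set" where
  "projective_points n =
     {{(\<lambda>i. c * v i) | c. True} | v. v \<in> coordinate_space (Suc n) \<and> v \<noteq> (\<lambda>_. 0)}"

definition projective_topology :: "nat \<Rightarrow> (nat \<Rightarrow> 'k :: field) set topology" where
  "projective_topology n =
     topology_generated_by
       {{L \<in> projective_points n. \<forall>v\<in>L - {\<lambda>_. 0}. p v \<noteq> 0} | p d. homogeneous_form (Suc n) d p}"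

definition projective_space :: "nat \<Rightarrow> ((nat \<Rightarrow> 'k :: alg_closed_field) set, 'k) function_space" where
  "projective_space n =
     \<lparr>zariski = projective_topology n,
      regular = (\<lambda>U f. openin (projective_topology n) U \<and>
        (\<forall>L\<in>U. \<exists>V d p q. openin (projective_topology n) V \<and> L \<in> V \<and> V \<subseteq> U \<and>
           homogeneous_form (Suc n) d p \<and> homogeneous_form (Suc n) d q \<and>
           (\<forall>M\<in>V. \<forall>v\<in>M - {\<lambda>_. 0}. q v \<noteq> 0 \<and> f M = p v / q v)))\<rparr>"


section \<open>Varieties and algebraic groups\<close>

definition affine_variety :: "('a, 'k :: alg_closed_field) function_space \<Rightarrow> bool" where
  "affine_variety S \<longleftrightarrow> space_with_functions S \<and>
     (\<exists>n Z h. closedin (zariski (affine_space n)) Z \<and>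
        isomorphism S (induced_space (affine_space n) Z) h)"

text \<open>Affine varieties may be reducible, so that all linear algebraic groups are covered; varieties
  are irreducible and separated.\<close>

definition variety :: "('a, 'k :: alg_closed_field) function_space \<Rightarrow> bool" where
  "variety S \<longleftrightarrow> space_with_functions S \<and>
     (\<exists>\<U>. finite \<U> \<and> \<Union>\<U> = points S \<and>
        (\<forall>U\<in>\<U>. openin (zariski S) U \<and> affine_variety (induced_space S U))) \<and>
     points S \<noteq> {} \<and>
     (\<forall>U V. openin (zariski S) U \<and> openin (zariski S) V \<and> U \<noteq> {} \<and> V \<noteq> {} \<longrightarrow> U \<inter> V \<noteq> {}) \<and>
     closedin (zariski (product_space S S)) {(x, x) | x. x \<in> points S}"

record ('g, 'k) algebraic_group = "'g monoid" +
  underlying :: "('g, 'k) function_space"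

locale linear_algebraic_group = group G
  for G :: "('g, 'k :: alg_closed_field) algebraic_group" (structure) +
  assumes points_eq_carrier: "points (underlying G) = carrier G"
    and affine: "affine_variety (underlying G)"
    and mult_morphism:
      "morphism (product_space (underlying G) (underlying G)) (underlying G) (\<lambda>(x, y). x \<otimes> y)"
    and inv_morphism: "morphism (underlying G) (underlying G) (\<lambda>x. inv x)"

definition algebraic_automorphism ::
  "('g, 'k) algebraic_group \<Rightarrow> ('g \<Rightarrow> 'g) \<Rightarrow> bool" where
  "algebraic_automorphism G \<alpha> \<longleftrightarrow> \<alpha> \<in> iso G G \<and> isomorphism (underlying G) (underlying G) \<alpha>"

definition vector_group :: "nat \<Rightarrow> (nat \<Rightarrow> 'k :: alg_closed_field, 'k) algebraic_group" where
  "vector_group n =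
     \<lparr>carrier = coordinate_space n, monoid.mult = (\<lambda>x y i. x i + y i), one = (\<lambda>_. 0),
      underlying = affine_space n\<rparr>"


section \<open>\<open>G\<close>-varieties\<close>

definition generically :: "('a, 'k) function_space \<Rightarrow> ('a \<Rightarrow> bool) \<Rightarrow> bool" where
  "generically S P \<longleftrightarrow> (\<exists>U. openin (zariski S) U \<and> U \<noteq> {} \<and> (\<forall>x\<in>U. P x))"

text \<open>The stabilizer is taken on closed points; over a field of characteristic 0 this agrees with the
  group scheme stabilizer, which is reduced.\<close>

definition G_variety ::
  "('g, 'k :: alg_closed_field) algebraic_group \<Rightarrow> ('a, 'k) function_space \<Rightarrow>
     ('g \<Rightarrow> 'a \<Rightarrow> 'a) \<Rightarrow> bool" where
  "G_variety G S \<phi> \<longleftrightarrow>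
     linear_algebraic_group G \<and> connected_space (zariski (underlying G)) \<and> variety S \<and>
     group_action G (points S) \<phi> \<and>
     morphism (product_space (underlying G) S) S (\<lambda>(g, x). \<phi> g x) \<and>
     generically S (\<lambda>x. stabilizer G \<phi> x = {\<one>\<^bsub>G\<^esub>}) \<and>
     generically S (\<lambda>x. zariski S closure_of orbit G \<phi> x = points S)"

text \<open>A \<open>G\<close>-structure on a variety \<open>T\<close> is an action \<open>\<phi>\<close> with \<^term>\<open>G_variety G T \<phi>\<close>.\<close>

definition equivalent_G_varieties ::
  "('g, 'k) algebraic_group \<Rightarrow> ('a, 'k) function_space \<Rightarrow> ('g \<Rightarrow> 'a \<Rightarrow> 'a) \<Rightarrow>
     ('b, 'k) function_space \<Rightarrow> ('g \<Rightarrow> 'b \<Rightarrow> 'b) \<Rightarrow> bool" where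
  "equivalent_G_varieties G S\<^sub>1 \<phi>\<^sub>1 S\<^sub>2 \<phi>\<^sub>2 \<longleftrightarrow>
     (\<exists>\<alpha> j. algebraic_automorphism G \<alpha> \<and> isomorphism S\<^sub>1 S\<^sub>2 j \<and>
        (\<forall>g\<in>carrier G. \<forall>x\<in>points S\<^sub>1. j (\<phi>\<^sub>1 g x) = \<phi>\<^sub>2 (\<alpha> g) (j x)))"

type_synonym Qbar = "rat alg_closure"

end

theory Submission
  imports Defs
begin

text \<open>
  Let \<open>x\<close> be a point of \<open>P\<^sup>1\<close> with trivial stabilizer under an action of the additive group. Its orbit
  map is an injective morphism from the affine line, so it has the form \<open>t \<mapsto> [p(t) : q(t)]\<close> for
  polynomials \<open>p, q\<close> without common roots. In characteristic 0 injectivity forces both degrees to be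
  at most one, so the orbit map is the restriction of a fractional linear transformation \<open>M\<close>. Hence
  \<open>M\<close> conjugates the given action to the translations \<open>[u : v] \<mapsto> [u + t v : v]\<close>: on the orbit because
  \<open>x\<close> moves by the group law, and at the one remaining point because it is fixed. So any two
  structures are equivalent by a fractional linear transformation and the identity of the group.
\<close>

text \<open>The orbit map is known only through local quotients of polynomials, so the global pair
  \<open>p\<close>, \<open>q\<close> has to be assembled. What makes this possible is that nonempty
  open subsets of the affine line are cofinite: two local descriptions agree at almost all points,
  hence identically. Characteristic 0 is essential for the degree bound: in characteristic p the
  Frobenius map t \<mapsto> t^p is injective of degree p. In characteristic 0 only finitely many
  points can be ramified, while an injective map of higher degree would be ramified in almost every
  fibre. The remaining point is fixed because its complement, the orbit, is invariant. The identity
  can serve as the group automorphism because a rescaling t \<mapsto> c t of the parameter is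
  realized on the line by z \<mapsto> c z and is therefore absorbed by the matrix of
  \<open>M\<close>. The general theory of spaces, products and charts serves existence as well: it
  must be verified that the additive group is a linear algebraic group, that the projective line is
  a variety, and that translation is a morphism on a product.\<close>

section \<open>Spaces with functions given by local conditions\<close>

text \<open>Affine, projective, induced and product spaces all call a function regular when near
  each point it has a prescribed shape. \<open>F W f\<close> stands for that shape on exactly the
  set \<open>W\<close>, and the axioms are checked for shapes only. \<open>F\<close> is not assumed
  to be closed under restriction, since shapes on a product live on special open sets.\<close>

lemma space_with_functionsI:
  fixes S :: "('a, 'k :: field) function_space"
  assumes regular_iff: "\<And>U f. regular S U f \<longleftrightarrow>
      openin (zariski S) U \<and> (\<forall>x\<in>U. \<exists>W. x \<in> W \<and> W \<subseteq> U \<and> F W f)"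
    and F_open: "\<And>W f. F W f \<Longrightarrow> openin (zariski S) W"
    and F_cong: "\<And>W f g. \<lbrakk>F W f; \<And>x. x \<in> W \<Longrightarrow> g x = f x\<rbrakk> \<Longrightarrow> F W g"
    and F_const: "\<And>U c x. \<lbrakk>openin (zariski S) U; x \<in> U\<rbrakk> \<Longrightarrow> \<exists>W. x \<in> W \<and> W \<subseteq> U \<and> F W (\<lambda>_. c)"
    and F_add: "\<And>W W' f g. \<lbrakk>F W f; F W' g\<rbrakk> \<Longrightarrow> F (W \<inter> W') (\<lambda>x. f x + g x)"
    and F_mult: "\<And>W W' f g. \<lbrakk>F W f; F W' g\<rbrakk> \<Longrightarrow> F (W \<inter> W') (\<lambda>x. f x * g x)"
    and F_inverse: "\<And>W f. F W f \<Longrightarrow> F {x \<in> W. f x \<noteq> 0} (\<lambda>x. inverse (f x))"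
  shows "space_with_functions S"
proof
  fix U f assume "regular S U f" then show "openin (zariski S) U"
    using regular_iff by blast
next
  fix U f g assume *: "regular S U f" "\<And>x. x \<in> U \<Longrightarrow> g x = f x"
  have "\<exists>W. x \<in> W \<and> W \<subseteq> U \<and> F W g" if "x \<in> U" for x
  proof -
    from * that obtain W where W: "x \<in> W" "W \<subseteq> U" "F W f" unfolding regular_iff by blast
    have "F W g" by (rule F_cong[OF W(3)]) (use W *(2) in auto)
    with W show ?thesis by blast
  qed
  with * show "regular S U g" unfolding regular_iff by blast
next
  fix U c assume "openin (zariski S) U" then show "regular S U (\<lambda>_. c)"
    unfolding regular_iff using F_const by blast
next
  have binary: "regular S U (\<lambda>x. b (f x) (g x))"
    if b: "\<And>W W' f g. \<lbrakk>F W f; F W' g\<rbrakk> \<Longrightarrow> F (W \<inter> W') (\<lambda>x. b (f x) (g x))"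
      and f: "regular S U f" and g: "regular S U g" for U f g b
    unfolding regular_iff
  proof safe
    show "openin (zariski S) U" using f unfolding regular_iff by blast
    fix x assume x: "x \<in> U"
    obtain W where W: "x \<in> W" "W \<subseteq> U" "F W f" using f x unfolding regular_iff by blast
    obtain W' where W': "x \<in> W'" "W' \<subseteq> U" "F W' g" using g x unfolding regular_iff by blast
    show "\<exists>W. x \<in> W \<and> W \<subseteq> U \<and> F W (\<lambda>x. b (f x) (g x))"
      using W W' b by (intro exI[of _ "W \<inter> W'"]) blast
  qed
  fix U f g assume fg: "regular S U f" "regular S U g"
  show "regular S U (\<lambda>x. f x + g x)" by (rule binary[OF F_add fg])
  show "regular S U (\<lambda>x. f x * g x)" by (rule binary[OF F_mult fg])
next
  fix \<U> f assume \<U>: "\<And>U. U \<in> \<U> \<Longrightarrow> openin (zariski S) U"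
  show "regular S (\<Union>\<U>) f \<longleftrightarrow> (\<forall>U\<in>\<U>. regular S U f)"
  proof
    assume r: "regular S (\<Union>\<U>) f"
    show "\<forall>U\<in>\<U>. regular S U f"
      unfolding regular_iff
    proof (intro ballI conjI \<U>)
      fix U x assume U: "U \<in> \<U>" and x: "x \<in> U"
      obtain W where W: "x \<in> W" "F W f" using r U x unfolding regular_iff by blast
      \<comment> \<open>Adding the zero function, which has the shape on a small neighbourhood
        inside \<open>U\<close>, cuts \<open>W\<close> down to a set contained in
        \<open>U\<close>.\<close>
      obtain W' where W': "x \<in> W'" "W' \<subseteq> U" "F W' (\<lambda>_. 0)" using F_const[OF \<U>[OF U] x] by blast
      from F_add[OF W(2) W'(3)] have "F (W \<inter> W') f" by simp
      with W W' show "\<exists>W. x \<in> W \<and> W \<subseteq> U \<and> F W f" by blast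
    qed
  next
    assume r: "\<forall>U\<in>\<U>. regular S U f"
    have "openin (zariski S) (\<Union>\<U>)" using \<U> by blast
    moreover have "\<exists>W. x \<in> W \<and> W \<subseteq> \<Union>\<U> \<and> F W f" if "x \<in> \<Union>\<U>" for x
      using that r unfolding regular_iff by (meson UnionE Union_upper order_trans)
    ultimately show "regular S (\<Union>\<U>) f" unfolding regular_iff by blast
  qed
next
  fix U f assume r: "regular S U f"
  \<comment> \<open>One local statement serves both axioms: shapes have open domains, so a shape for
    the inverse also shows that the nonvanishing set is open.\<close>
  have inv: "\<exists>W. x \<in> W \<and> W \<subseteq> {x \<in> U. f x \<noteq> 0} \<and> F W (\<lambda>x. inverse (f x))"
    if x: "x \<in> U" "f x \<noteq> 0" for x
  proof -
    obtain W where W: "x \<in> W" "W \<subseteq> U" "F W f" using r x unfolding regular_iff by blast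
    then show ?thesis using F_inverse[OF W(3)] x
      by (intro exI[of _ "{x \<in> W. f x \<noteq> 0}"]) blast
  qed
  show "openin (zariski S) {x \<in> U. f x \<noteq> 0}"
  proof (subst openin_subopen, rule ballI)
    fix x assume "x \<in> {x \<in> U. f x \<noteq> 0}"
    then obtain W where "x \<in> W" "W \<subseteq> {x \<in> U. f x \<noteq> 0}" "F W (\<lambda>x. inverse (f x))"
      using inv[of x] by blast
    then show "\<exists>W. openin (zariski S) W \<and> x \<in> W \<and> W \<subseteq> {x \<in> U. f x \<noteq> 0}"
      using F_open[of W] by blast
  qed
  with inv show "regular S {x \<in> U. f x \<noteq> 0} (\<lambda>x. inverse (f x))"
    unfolding regular_iff by blast
qed

context space_with_functions
begin

text \<open>Restriction is not an axiom. For \<open>V \<subseteq> U\<close> the family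
  \<open>{U, V}\<close> covers \<open>U\<close>, and the sheaf condition for this cover returns
  regularity on both members.\<close>

lemma regular_subset:
  assumes "regular S U f" "openin (zariski S) V" "V \<subseteq> U"
  shows "regular S V f"
proof -
  have "\<Union>{U, V} = U" using assms(3) by auto
  then have "regular S (\<Union>{U, V}) f" using assms(1) by simp
  moreover have "openin (zariski S) W" if "W \<in> {U, V}" for W
    using that assms regular_open by auto
  ultimately show ?thesis using regular_sheaf[of "{U, V}" f] by blast
qed

lemma regular_local:
  assumes "\<And>x. x \<in> U \<Longrightarrow> \<exists>V. x \<in> V \<and> V \<subseteq> U \<and> regular S V f"
  shows "regular S U f"
proof -
  let ?\<U> = "{V. V \<subseteq> U \<and> regular S V f}"
  have "regular S (\<Union>?\<U>) f" by (subst regular_sheaf) (auto intro: regular_open)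
  moreover have "\<Union>?\<U> = U" using assms by blast
  ultimately show ?thesis by simp
qed

lemma regular_sum:
  "\<lbrakk>openin (zariski S) U; \<And>i. i \<in> I \<Longrightarrow> regular S U (f i)\<rbrakk> \<Longrightarrow> regular S U (\<lambda>x. \<Sum>i\<in>I. f i x)"
  by (induction I rule: infinite_finite_induct) (auto intro: regular_const regular_add)

lemma regular_prod:
  "\<lbrakk>openin (zariski S) U; \<And>i. i \<in> I \<Longrightarrow> regular S U (f i)\<rbrakk> \<Longrightarrow> regular S U (\<lambda>x. \<Prod>i\<in>I. f i x)"
  by (induction I rule: infinite_finite_induct) (auto intro: regular_const regular_mult)

lemma regular_power:
  assumes "regular S U f" shows "regular S U (\<lambda>x. f x ^ n)"
  using regular_prod[of U "{..<n}" "\<lambda>_. f"] assms regular_open by auto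

lemma regular_uminus:
  assumes "regular S U f" shows "regular S U (\<lambda>x. - f x)"
  using regular_mult[OF regular_const[of U "-1"] assms] regular_open[OF assms] by simp

lemma regular_diff:
  "\<lbrakk>regular S U f; regular S U g\<rbrakk> \<Longrightarrow> regular S U (\<lambda>x. f x - g x)"
  using regular_add[OF _ regular_uminus] by fastforce

lemma regular_divide:
  assumes f: "regular S U f" and g: "regular S U g" and nz: "\<And>x. x \<in> U \<Longrightarrow> g x \<noteq> 0"
  shows "regular S U (\<lambda>x. f x / g x)"
proof -
  have "{x \<in> U. g x \<noteq> 0} = U" using nz by auto
  then show ?thesis using regular_mult[OF f, of "\<lambda>x. inverse (g x)"] regular_inverse[OF g]
    by (simp add: field_simps)
qed

lemma regular_polynomial:
  assumes "polynomial_function n p" "\<And>i. i < n \<Longrightarrow> regular S U (\<lambda>x. a x i)" "openin (zariski S) U"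
  shows "regular S U (\<lambda>x. p (a x))"
  using assms unfolding polynomial_function_def
  by (auto intro!: regular_sum regular_mult regular_const regular_prod regular_power)

end

section \<open>Morphisms, subspaces and products\<close>

section \<open>Morphisms\<close>

lemma morphism_comp:
  assumes "morphism S T h" "morphism T R h'"
  shows "morphism S R (h' \<circ> h)"
proof -
  have c: "continuous_map (zariski S) (zariski T) h" using assms unfolding morphism_def by blast
  have "regular S {x \<in> points S. (h' \<circ> h) x \<in> V} (f \<circ> (h' \<circ> h))" if "regular R V f" for V f
  proof -
    have "regular T {y \<in> points T. h' y \<in> V} (f \<circ> h')"
      using assms(2) that unfolding morphism_def by blast
    then have "regular S {x \<in> points S. h x \<in> {y \<in> points T. h' y \<in> V}} (f \<circ> h' \<circ> h)"
      using assms(1) unfolding morphism_def by blast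
    moreover have "{x \<in> points S. h x \<in> {y \<in> points T. h' y \<in> V}} = {x \<in> points S. (h' \<circ> h) x \<in> V}"
      using continuous_map_image_subset_topspace[OF c] by auto
    ultimately show ?thesis by (simp add: comp_assoc)
  qed
  with assms show ?thesis unfolding morphism_def by (blast intro: continuous_map_compose)
qed

lemma morphism_points: "\<lbrakk>morphism S T h; x \<in> points S\<rbrakk> \<Longrightarrow> h x \<in> points T"
  unfolding morphism_def using continuous_map_image_subset_topspace by blast

lemma morphism_regular:
  "\<lbrakk>morphism S T h; regular T V f\<rbrakk> \<Longrightarrow> regular S {x \<in> points S. h x \<in> V} (\<lambda>x. f (h x))"
  unfolding morphism_def comp_def by blast

lemma morphism_open:
  "\<lbrakk>morphism S T h; openin (zariski T) V\<rbrakk> \<Longrightarrow> openin (zariski S) {x \<in> points S. h x \<in> V}"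
  unfolding morphism_def continuous_map_def by blast

lemma (in space_with_functions) morphism_id: "morphism S S (\<lambda>x. x)"
  unfolding morphism_def
proof (intro conjI allI impI)
  fix V f assume r: "regular S V f"
  then have "{x \<in> points S. x \<in> V} = V" using openin_subset[OF regular_open] by blast
  with r show "regular S {x \<in> points S. x \<in> V} (f \<circ> (\<lambda>x. x))" by (simp add: comp_def)
qed simp

lemma isomorphismI:
  assumes "morphism S T h" "morphism T S h'"
    and "\<And>x. x \<in> points S \<Longrightarrow> h' (h x) = x" "\<And>y. y \<in> points T \<Longrightarrow> h (h' y) = y"
  shows "isomorphism S T h"
  using assms unfolding isomorphism_def by blast

lemma isomorphism_comp:
  assumes "isomorphism S T h" "isomorphism T R k"
  shows "isomorphism S R (k \<circ> h)"
proof -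
  obtain h' where h': "morphism S T h" "morphism T S h'" "\<forall>x\<in>points S. h' (h x) = x"
    "\<forall>y\<in>points T. h (h' y) = y" using assms(1) unfolding isomorphism_def by blast
  obtain k' where k': "morphism T R k" "morphism R T k'" "\<forall>x\<in>points T. k' (k x) = x"
    "\<forall>y\<in>points R. k (k' y) = y" using assms(2) unfolding isomorphism_def by blast
  show ?thesis
    by (rule isomorphismI[OF morphism_comp[OF h'(1) k'(1)] morphism_comp[OF k'(2) h'(2)]])
      (use h' k' morphism_points in fastforce)+
qed

section \<open>Induced spaces\<close>

lemma points_induced_space: "points (induced_space S Z) = points S \<inter> Z"
  unfolding induced_space_def by simp

context space_with_functions
begin

lemma space_with_functions_induced: "space_with_functions (induced_space S Z)"
proof (rule space_with_functionsI[where F = "\<lambda>W f. \<exists>V g. W = V \<inter> Z \<and> regular S V g \<and> (\<forall>y\<in>W. f y = g y)"])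
  let ?F = "\<lambda>W f. \<exists>V g. W = V \<inter> Z \<and> regular S V g \<and> (\<forall>y\<in>W. f y = g y)"
  fix U f show "regular (induced_space S Z) U f \<longleftrightarrow>
      openin (zariski (induced_space S Z)) U \<and> (\<forall>x\<in>U. \<exists>W. x \<in> W \<and> W \<subseteq> U \<and> ?F W f)"
    (is "_ \<longleftrightarrow> ?o \<and> ?l")
  proof -
    have eq: "regular (induced_space S Z) U f \<longleftrightarrow> ?o \<and>
      (\<forall>x\<in>U. \<exists>V g. x \<in> V \<and> V \<inter> Z \<subseteq> U \<and> regular S V g \<and> (\<forall>y\<in>V \<inter> Z. f y = g y))"
      unfolding induced_space_def by simp
    show ?thesis
    proof (cases ?o)
      case True
      \<comment> \<open>The definition of the induced structure asks for \<open>x \<in> V\<close>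
        only; as \<open>U\<close> lies in \<open>Z\<close> this is the same as
        \<open>x \<in> V \<inter> Z\<close>, the domain of the shape.\<close>
      then have "U \<subseteq> Z" using openin_subset[of "zariski (induced_space S Z)" U]
        by (simp add: points_induced_space)
      then have "x \<in> U \<Longrightarrow> (x \<in> V \<and> V \<inter> Z \<subseteq> U \<and> regular S V g \<and> (\<forall>y\<in>V \<inter> Z. f y = g y)) \<longleftrightarrow>
          x \<in> V \<inter> Z \<and> V \<inter> Z \<subseteq> U \<and> regular S V g \<and> (\<forall>y\<in>V \<inter> Z. f y = g y)" for x V g
        by blast
      moreover have "(\<exists>W. x \<in> W \<and> W \<subseteq> U \<and> ?F W f) \<longleftrightarrow>
          (\<exists>V g. x \<in> V \<inter> Z \<and> V \<inter> Z \<subseteq> U \<and> regular S V g \<and> (\<forall>y\<in>V \<inter> Z. f y = g y))" for x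
        by metis
      ultimately show ?thesis unfolding eq by simp
    qed (simp add: eq)
  qed
next
  fix W f assume "\<exists>V g. W = V \<inter> Z \<and> regular S V g \<and> (\<forall>y\<in>W. f y = g y)"
  then show "openin (zariski (induced_space S Z)) W"
    unfolding induced_space_def using regular_open by (auto simp: openin_subtopology)
next
  fix W f g assume "\<exists>V g. W = V \<inter> Z \<and> regular S V g \<and> (\<forall>y\<in>W. f y = g y)"
    "\<And>x. x \<in> W \<Longrightarrow> g x = f x"
  then show "\<exists>V h. W = V \<inter> Z \<and> regular S V h \<and> (\<forall>y\<in>W. g y = h y)" by auto
next
  fix U c x assume "openin (zariski (induced_space S Z)) U" "x \<in> U"
  then show "\<exists>W. x \<in> W \<and> W \<subseteq> U \<and> (\<exists>V g. W = V \<inter> Z \<and> regular S V g \<and> (\<forall>y\<in>W. c = g y))"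
    unfolding induced_space_def using regular_const
    by (intro exI[of _ U]) (auto simp: openin_subtopology intro!: exI[of _ "\<lambda>_. c"])
next
  fix W W' f g
  assume "\<exists>V h. W = V \<inter> Z \<and> regular S V h \<and> (\<forall>y\<in>W. f y = h y)"
    "\<exists>V h. W' = V \<inter> Z \<and> regular S V h \<and> (\<forall>y\<in>W'. g y = h y)"
  then obtain V h V' h' where V: "W = V \<inter> Z" "regular S V h" "\<forall>y\<in>W. f y = h y"
    "W' = V' \<inter> Z" "regular S V' h'" "\<forall>y\<in>W'. g y = h' y" by blast
  have o: "openin (zariski S) (V \<inter> V')" using V regular_open by blast
  have r: "regular S (V \<inter> V') h" "regular S (V \<inter> V') h'"
    using V regular_subset[OF _ o] by auto
  show "\<exists>V h. W \<inter> W' = V \<inter> Z \<and> regular S V h \<and> (\<forall>y\<in>W \<inter> W'. f y + g y = h y)"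
    using V regular_add[OF r] by (intro exI[of _ "V \<inter> V'"] exI[of _ "\<lambda>x. h x + h' x"]) auto
  show "\<exists>V h. W \<inter> W' = V \<inter> Z \<and> regular S V h \<and> (\<forall>y\<in>W \<inter> W'. f y * g y = h y)"
    using V regular_mult[OF r] by (intro exI[of _ "V \<inter> V'"] exI[of _ "\<lambda>x. h x * h' x"]) auto
next
  fix W f assume "\<exists>V g. W = V \<inter> Z \<and> regular S V g \<and> (\<forall>y\<in>W. f y = g y)"
  then obtain V g where V: "W = V \<inter> Z" "regular S V g" "\<forall>y\<in>W. f y = g y" by blast
  show "\<exists>V g. {x \<in> W. f x \<noteq> 0} = V \<inter> Z \<and> regular S V g \<and>
      (\<forall>y\<in>{x \<in> W. f x \<noteq> 0}. inverse (f y) = g y)"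
    using V regular_inverse[OF V(2)]
    by (intro exI[of _ "{x \<in> V. g x \<noteq> 0}"] exI[of _ "\<lambda>x. inverse (g x)"]) auto
qed

lemma regular_induced_restrict:
  assumes "regular S V f" "W = V \<inter> Z"
  shows "regular (induced_space S Z) W f"
  unfolding induced_space_def using assms regular_open[OF assms(1)] 
  by (auto simp: openin_subtopology)

text \<open>For open \<open>Z\<close> the local extensions agree with \<open>f\<close> on the open
  sets \<open>V \<inter> Z\<close>, so \<open>f\<close> itself is regular there, and these pieces
  glue.\<close>

lemma regular_induced_open:
  assumes Z: "openin (zariski S) Z"
  shows "regular (induced_space S Z) U f \<longleftrightarrow> U \<subseteq> Z \<and> regular S U f"
proof
  assume r: "regular (induced_space S Z) U f"
  then have o: "openin (subtopology (zariski S) Z) U" unfolding induced_space_def by simp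
  then have sub: "U \<subseteq> Z" and oU: "openin (zariski S) U"
    using Z openin_trans_full by (auto simp: openin_subtopology)
  have "regular S U f"
  proof (rule regular_local)
    fix x assume x: "x \<in> U"
    then obtain V g where V: "x \<in> V" "V \<inter> Z \<subseteq> U" "regular S V g" "\<forall>y\<in>V \<inter> Z. f y = g y"
      using r unfolding induced_space_def by auto
    have "regular S (V \<inter> Z) g"
      using regular_subset[OF V(3), of "V \<inter> Z"] openin_Int[OF regular_open[OF V(3)] Z] by blast
    then have "regular S (V \<inter> Z) f" by (rule regular_cong) (use V(4) in auto)
    moreover have "x \<in> V \<inter> Z" using V(1) x sub by blast
    ultimately show "\<exists>V. x \<in> V \<and> V \<subseteq> U \<and> regular S V f" using V(2) by metis
  qed
  with sub show "U \<subseteq> Z \<and> regular S U f" ..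
qed (auto intro: regular_induced_restrict)

text \<open>An equality of records, not only an isomorphism. It lets affine space be presented as a
  closed subset of itself when \<open>affine_variety\<close> is checked.\<close>

lemma induced_space_points: "induced_space S (points S) = S"
proof -
  have "regular (induced_space S (points S)) = regular S"
    by (intro ext) (metis regular_induced_open[OF openin_topspace] regular_open openin_subset)
  moreover have "zariski (induced_space S (points S)) = zariski S"
    unfolding induced_space_def by (simp add: subtopology_topspace)
  ultimately show ?thesis by simp
qed

text \<open>If \<open>g\<close> extends \<open>f\<close> locally, the pullbacks of \<open>f\<close>
  and \<open>g\<close> along \<open>h\<close> agree because \<open>h\<close> lands in
  \<open>Z\<close>. Maps between charts and hyperplanes can thus be built into the ambient space
  first.\<close>

lemma morphism_into_induced:
  assumes h: "morphism S T h" and T: "space_with_functions T" and im: "\<And>x. x \<in> points S \<Longrightarrow> h x \<in> Z"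
  shows "morphism S (induced_space T Z) h"
  unfolding morphism_def
proof (intro conjI allI impI)
  show "continuous_map (zariski S) (zariski (induced_space T Z)) h"
    using h im unfolding morphism_def induced_space_def by (auto simp: continuous_map_in_subtopology)
  fix V f assume r: "regular (induced_space T Z) V f"
  show "regular S {x \<in> points S. h x \<in> V} (f \<circ> h)"
  proof (rule regular_local)
    fix x assume x: "x \<in> {x \<in> points S. h x \<in> V}"
    then obtain W g where W: "h x \<in> W" "W \<inter> Z \<subseteq> V" "regular T W g" "\<forall>y\<in>W \<inter> Z. f y = g y"
      using r unfolding induced_space_def by auto
    have "regular S {x \<in> points S. h x \<in> W} (g \<circ> h)" using h W unfolding morphism_def by blast
    then have "regular S {x \<in> points S. h x \<in> W} (f \<circ> h)"
      by (rule regular_cong) (use W im in auto)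
    then show "\<exists>V'. x \<in> V' \<and> V' \<subseteq> {x \<in> points S. h x \<in> V} \<and> regular S V' (f \<circ> h)"
      using x W im by (intro exI[of _ "{x \<in> points S. h x \<in> W}"]) auto
  qed
qed

end

section \<open>Products\<close>

text \<open>Open sets of a generated topology arise from generators by finite intersections and
  unions. If the generators are closed under intersection, a single generator fits around each
  point; this makes open sets of products and of the affine line concrete.\<close>

lemma openin_topology_generated_by_basis:
  assumes "openin (topology_generated_by B) U" "x \<in> U"
    and Int: "\<And>V W. \<lbrakk>V \<in> B; W \<in> B\<rbrakk> \<Longrightarrow> V \<inter> W \<in> B"
  shows "\<exists>W\<in>B. x \<in> W \<and> W \<subseteq> U"
proof -
  have "generate_topology_on B U" using assms(1) by (simp add: openin_topology_generated_by_iff)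
  then show ?thesis using assms(2)
  proof (induction arbitrary: x)
    case (Int V W)
    then obtain V' W' where "V' \<in> B" "x \<in> V'" "V' \<subseteq> V" "W' \<in> B" "x \<in> W'" "W' \<subseteq> W"
      by (metis IntE)
    then show ?case by (intro bexI[of _ "V' \<inter> W'"] assms(3)) auto
  next
    case (UN K)
    then obtain k where k: "k \<in> K" "x \<in> k" by blast
    then obtain W where "W \<in> B" "x \<in> W" "W \<subseteq> k" using UN.IH by metis
    then show ?case using k by (intro bexI[of _ W]) auto
  qed auto
qed

text \<open>The image of the tensor product of the two rings of regular functions inside the
  functions on pairs. Hiding the length and the families of a \<open>tensor_sum\<close> allows these
  functions to be handled as a ring.\<close>

definition tensor_function ::
  "('a, 'k :: field) function_space \<Rightarrow> ('b, 'k) function_space \<Rightarrow> 'a set \<Rightarrow> 'b set \<Rightarrow>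
     ('a \<times> 'b \<Rightarrow> 'k) \<Rightarrow> bool" where
  "tensor_function S T U V h \<longleftrightarrow>
     (\<exists>n f g. (\<forall>i<n. regular S U (f i) \<and> regular T V (g i)) \<and> h = tensor_sum n f g)"

lemma tensor_function_regular:
  "\<lbrakk>regular S U f; regular T V g\<rbrakk> \<Longrightarrow> tensor_function S T U V (\<lambda>(x, y). f x * g y)"
  unfolding tensor_function_def tensor_sum_def
  by (intro exI[of _ "1::nat"] exI[of _ "\<lambda>_. f"] exI[of _ "\<lambda>_. g"]) simp

lemma tensor_function_add:
  assumes "tensor_function S T U V h" "tensor_function S T U V k"
  shows "tensor_function S T U V (\<lambda>p. h p + k p)"
proof -
  obtain n f g where h: "\<forall>i<n. regular S U (f i) \<and> regular T V (g i)" "h = tensor_sum n f g"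
    using assms(1) unfolding tensor_function_def by blast
  obtain m f' g' where k: "\<forall>i<m. regular S U (f' i) \<and> regular T V (g' i)" "k = tensor_sum m f' g'"
    using assms(2) unfolding tensor_function_def by blast
  define F where "F = (\<lambda>i. if i < n then f i else f' (i - n))"
  define G where "G = (\<lambda>i. if i < n then g i else g' (i - n))"
  have "tensor_sum (n + m) F G p = h p + k p" for p
  proof (cases p)
    case (Pair x y)
    have "(\<Sum>i<n + m. F i x * G i y) = (\<Sum>i<n. F i x * G i y) + (\<Sum>i<m. F (n + i) x * G (n + i) y)"
      by (induction m) (simp_all add: add.assoc)
    moreover have "(\<Sum>i<n. F i x * G i y) = (\<Sum>i<n. f i x * g i y)"
      by (rule sum.cong) (simp_all add: F_def G_def)
    ultimately show ?thesis unfolding Pair h k tensor_sum_def by (simp add: F_def G_def)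
  qed
  moreover have "\<forall>i<n+m. regular S U (F i) \<and> regular T V (G i)"
    using h(1) k(1) unfolding F_def G_def by auto
  ultimately show ?thesis unfolding tensor_function_def
    by (intro exI[of _ "n + m"] exI[of _ F] exI[of _ G]) (simp add: fun_eq_iff)
qed

context
  fixes S :: "('a, 'k :: field) function_space" and T :: "('b, 'k) function_space"
  assumes S: "space_with_functions S" and T: "space_with_functions T"
begin

interpretation S: space_with_functions S by (rule S)
interpretation T: space_with_functions T by (rule T)

lemma tensor_function_subset:
  assumes "tensor_function S T U V h" "openin (zariski S) U'" "openin (zariski T) V'"
    "U' \<subseteq> U" "V' \<subseteq> V"
  shows "tensor_function S T U' V' h"
proof -
  obtain n f g where h: "\<forall>i<n. regular S U (f i) \<and> regular T V (g i)" "h = tensor_sum n f g"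
    using assms(1) unfolding tensor_function_def by blast
  then have "\<forall>i<n. regular S U' (f i) \<and> regular T V' (g i)"
    using S.regular_subset[OF _ assms(2,4)] T.regular_subset[OF _ assms(3,5)] by simp
  with h(2) show ?thesis unfolding tensor_function_def by blast
qed

lemma tensor_function_const:
  assumes "openin (zariski S) U" "openin (zariski T) V"
  shows "tensor_function S T U V (\<lambda>_. c)"
  using tensor_function_regular[OF S.regular_const[OF assms(1), of c] T.regular_const[OF assms(2), of 1]]
  by (simp add: case_prod_unfold)

lemma tensor_function_sum:
  assumes "openin (zariski S) U" "openin (zariski T) V"
    and "\<And>i. i \<in> I \<Longrightarrow> tensor_function S T U V (h i)"
  shows "tensor_function S T U V (\<lambda>p. \<Sum>i\<in>I. h i p)"
  using assms(3)
  by (induction I rule: infinite_finite_induct)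
    (auto intro: tensor_function_add tensor_function_const[OF assms(1,2)])

lemma tensor_function_mult:
  assumes "tensor_function S T U V h" "tensor_function S T U V k"
    "openin (zariski S) U" "openin (zariski T) V"
  shows "tensor_function S T U V (\<lambda>p. h p * k p)"
proof -
  obtain n f g where h: "\<And>i. i < n \<Longrightarrow> regular S U (f i) \<and> regular T V (g i)" "h = tensor_sum n f g"
    using assms(1) unfolding tensor_function_def by blast
  obtain m f' g' where k: "\<And>i. i < m \<Longrightarrow> regular S U (f' i) \<and> regular T V (g' i)" "k = tensor_sum m f' g'"
    using assms(2) unfolding tensor_function_def by blast
  have "(\<lambda>p. h p * k p) =
      (\<lambda>p. \<Sum>i<n. \<Sum>j<m. (\<lambda>(x, y). (f i x * f' j x) * (g i y * g' j y)) p)"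
    unfolding h k tensor_sum_def
    by (intro ext) (simp add: case_prod_unfold sum_product mult.assoc mult.left_commute)
  moreover have "tensor_function S T U V (\<lambda>(x, y). (f i x * f' j x) * (g i y * g' j y))"
    if "i < n" "j < m" for i j
    using tensor_function_regular[OF S.regular_mult T.regular_mult] h(1)[OF that(1)] k(1)[OF that(2)]
    by blast
  ultimately show ?thesis using assms(3,4) by (auto intro!: tensor_function_sum)
qed

lemma product_topology_basis_iff:
  "W \<in> product_topology_basis S T \<longleftrightarrow>
     (\<exists>U V h. openin (zariski S) U \<and> openin (zariski T) V \<and> tensor_function S T U V h \<and>
        W = {p \<in> U \<times> V. h p \<noteq> 0})"
proof
  assume "W \<in> product_topology_basis S T"
  then obtain U V n f g where W: "W = tensor_nonzero U V n f g" "openin (zariski S) U"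
    "openin (zariski T) V" "\<forall>i<n. regular S U (f i) \<and> regular T V (g i)"
    unfolding product_topology_basis_def by blast
  moreover have "tensor_function S T U V (tensor_sum n f g)"
    using W unfolding tensor_function_def by blast
  ultimately show "\<exists>U V h. openin (zariski S) U \<and> openin (zariski T) V \<and> tensor_function S T U V h \<and>
      W = {p \<in> U \<times> V. h p \<noteq> 0}"
    unfolding tensor_nonzero_def by blast
next
  assume "\<exists>U V h. openin (zariski S) U \<and> openin (zariski T) V \<and> tensor_function S T U V h \<and>
      W = {p \<in> U \<times> V. h p \<noteq> 0}"
  then show "W \<in> product_topology_basis S T"
    unfolding product_topology_basis_def tensor_function_def tensor_nonzero_def by blast
qed

lemma product_topology_basisE:
  assumes "W \<in> product_topology_basis S T"
  obtains U V h where "openin (zariski S) U" "openin (zariski T) V" "tensor_function S T U V h"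
    "W = {p \<in> U \<times> V. h p \<noteq> 0}"
  using assms unfolding product_topology_basis_iff by (elim exE conjE)

text \<open>On the intersection of the two rectangles, the product of the tensor functions is
  nonzero exactly where both factors are. So the generators of the product topology form a
  basis.\<close>

lemma product_topology_basis_Int:
  assumes "W \<in> product_topology_basis S T" "W' \<in> product_topology_basis S T"
  shows "W \<inter> W' \<in> product_topology_basis S T"
proof -
  obtain U V h where W: "openin (zariski S) U" "openin (zariski T) V" "tensor_function S T U V h"
    "W = {p \<in> U \<times> V. h p \<noteq> 0}" by (rule product_topology_basisE[OF assms(1)])
  obtain U' V' h' where W': "openin (zariski S) U'" "openin (zariski T) V'" "tensor_function S T U' V' h'"
    "W' = {p \<in> U' \<times> V'. h' p \<noteq> 0}" by (rule product_topology_basisE[OF assms(2)])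
  have o: "openin (zariski S) (U \<inter> U')" "openin (zariski T) (V \<inter> V')" using W W' by auto
  have "tensor_function S T (U \<inter> U') (V \<inter> V') (\<lambda>p. h p * h' p)"
    by (rule tensor_function_mult[OF tensor_function_subset[OF W(3) o] tensor_function_subset[OF W'(3) o] o]) auto
  moreover have "W \<inter> W' = {p \<in> (U \<inter> U') \<times> (V \<inter> V'). h p * h' p \<noteq> 0}"
    using W(4) W'(4) by auto
  ultimately show ?thesis using o unfolding product_topology_basis_iff by blast
qed

lemma points_product_space: "points (product_space S T) = points S \<times> points T"
proof -
  have "topspace (topology_generated_by (product_topology_basis S T)) = \<Union>(product_topology_basis S T)"
    by (rule topology_generated_by_topspace)
  also have "\<dots> = points S \<times> points T"
  proof
    show "\<Union>(product_topology_basis S T) \<subseteq> points S \<times> points T"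
    proof
      fix p assume "p \<in> \<Union>(product_topology_basis S T)"
      then obtain W where W: "p \<in> W" "W \<in> product_topology_basis S T" by blast
      from W(2) obtain U V h where "openin (zariski S) U" "openin (zariski T) V"
        "tensor_function S T U V h" "W = {p \<in> U \<times> V. h p \<noteq> 0}"
        by (rule product_topology_basisE)
      with W show "p \<in> points S \<times> points T" using openin_subset[of "zariski S"] openin_subset[of "zariski T"]
        by auto
    qed
    have "points S \<times> points T \<in> product_topology_basis S T"
      unfolding product_topology_basis_iff
      by (intro exI[of _ "points S"] exI[of _ "points T"] exI[of _ "\<lambda>_. 1"])
        (auto intro: tensor_function_const)
    then show "points S \<times> points T \<subseteq> \<Union>(product_topology_basis S T)" by blast
  qed
  finally show ?thesis unfolding product_space_def by simp
qed

lemma openin_product_spaceI: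
  "\<lbrakk>openin (zariski S) U; openin (zariski T) V; tensor_function S T U V h\<rbrakk> \<Longrightarrow>
     openin (zariski (product_space S T)) {p \<in> U \<times> V. h p \<noteq> 0}"
  unfolding product_space_def function_space.simps
  by (rule topology_generated_by_Basis) (unfold product_topology_basis_iff, intro exI conjI, assumption+, rule refl)

text \<open>The shape of regular functions on a product. Its domain is the full nonvanishing set of
  the denominator in a rectangle, that is, a basic open set; the numerators and denominators below
  are chosen so that this stays exact.\<close>

definition tensor_quotient :: "('a \<times> 'b) set \<Rightarrow> ('a \<times> 'b \<Rightarrow> 'k) \<Rightarrow> bool" where
  "tensor_quotient W h \<longleftrightarrow>
     (\<exists>U V a c. openin (zariski S) U \<and> openin (zariski T) V \<and>
        tensor_function S T U V a \<and> tensor_function S T U V c \<and>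
        W = {p \<in> U \<times> V. c p \<noteq> 0} \<and> (\<forall>q\<in>W. h q = a q / c q))"

lemma tensor_quotientE:
  assumes "tensor_quotient W h"
  obtains U V a c where "openin (zariski S) U" "openin (zariski T) V"
    "tensor_function S T U V a" "tensor_function S T U V c"
    "W = {p \<in> U \<times> V. c p \<noteq> 0}" "\<forall>q\<in>W. h q = a q / c q"
  using assms unfolding tensor_quotient_def by (elim exE conjE)

lemma tensor_quotientI:
  assumes "openin (zariski S) U" "openin (zariski T) V"
    "tensor_function S T U V a" "tensor_function S T U V c"
    "W = {p \<in> U \<times> V. c p \<noteq> 0}" "\<And>q. q \<in> W \<Longrightarrow> h q = a q / c q"
  shows "tensor_quotient W h"
  unfolding tensor_quotient_def using assms by (intro exI conjI ballI)

lemma regular_product_space_iff: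
  "regular (product_space S T) W h \<longleftrightarrow>
     openin (zariski (product_space S T)) W \<and> (\<forall>p\<in>W. \<exists>W'. p \<in> W' \<and> W' \<subseteq> W \<and> tensor_quotient W' h)"
proof -
  have "(\<exists>U V m a b n c d. openin (zariski S) U \<and> openin (zariski T) V \<and>
           (\<forall>i<m. regular S U (a i) \<and> regular T V (b i)) \<and>
           (\<forall>i<n. regular S U (c i) \<and> regular T V (d i)) \<and>
           p \<in> tensor_nonzero U V n c d \<and> tensor_nonzero U V n c d \<subseteq> W \<and>
           (\<forall>q\<in>tensor_nonzero U V n c d. h q = tensor_sum m a b q / tensor_sum n c d q)) \<longleftrightarrow>
        (\<exists>W'. p \<in> W' \<and> W' \<subseteq> W \<and> tensor_quotient W' h)" (is "?l \<longleftrightarrow> ?r") for p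
  proof
    assume ?l
    then obtain U V m a b n c d where *: "openin (zariski S) U" "openin (zariski T) V"
      "\<forall>i<m. regular S U (a i) \<and> regular T V (b i)" "\<forall>i<n. regular S U (c i) \<and> regular T V (d i)"
      "p \<in> tensor_nonzero U V n c d" "tensor_nonzero U V n c d \<subseteq> W"
      "\<forall>q\<in>tensor_nonzero U V n c d. h q = tensor_sum m a b q / tensor_sum n c d q"
      by blast
    have "tensor_function S T U V (tensor_sum m a b)" "tensor_function S T U V (tensor_sum n c d)"
      using * unfolding tensor_function_def by blast+
    then have "tensor_quotient (tensor_nonzero U V n c d) h"
      using * unfolding tensor_quotient_def tensor_nonzero_def by blast
    with * show ?r by blast
  next
    assume ?r
    then obtain W' where pW': "p \<in> W'" "W' \<subseteq> W" and q: "tensor_quotient W' h" by blast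
    obtain U V a c where W': "openin (zariski S) U" "openin (zariski T) V"
        "tensor_function S T U V a" "tensor_function S T U V c"
        "W' = {p \<in> U \<times> V. c p \<noteq> 0}" "\<forall>q\<in>W'. h q = a q / c q"
      using q by (rule tensor_quotientE)
    note W' = pW' W'
    obtain m a1 b1 where a: "\<forall>i<m. regular S U (a1 i) \<and> regular T V (b1 i)" "a = tensor_sum m a1 b1"
      using W' unfolding tensor_function_def by blast
    obtain n c1 d1 where c: "\<forall>i<n. regular S U (c1 i) \<and> regular T V (d1 i)" "c = tensor_sum n c1 d1"
      using W' unfolding tensor_function_def by blast
    have "W' = tensor_nonzero U V n c1 d1" using W' c unfolding tensor_nonzero_def by simp
    with W' a c show ?l
      by (intro exI[of _ U] exI[of _ V] exI[of _ m] exI[of _ a1] exI[of _ b1] exI[of _ n]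
          exI[of _ c1] exI[of _ d1]) simp
  qed
  then show ?thesis unfolding product_space_def by simp
qed

lemma tensor_quotient_common:
  assumes "tensor_quotient W f" "tensor_quotient W' g"
  obtains U V a c a' c' where "openin (zariski S) U" "openin (zariski T) V"
    "tensor_function S T U V a" "tensor_function S T U V c"
    "tensor_function S T U V a'" "tensor_function S T U V c'"
    "W \<inter> W' = {p \<in> U \<times> V. c p * c' p \<noteq> 0}"
    "\<And>q. q \<in> W \<inter> W' \<Longrightarrow> f q = a q / c q \<and> g q = a' q / c' q"
proof -
  obtain U V a c where W: "openin (zariski S) U" "openin (zariski T) V"
    "tensor_function S T U V a" "tensor_function S T U V c"
    "W = {p \<in> U \<times> V. c p \<noteq> 0}" "\<forall>q\<in>W. f q = a q / c q"
    using assms(1) by (rule tensor_quotientE)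
  obtain U' V' a' c' where W': "openin (zariski S) U'" "openin (zariski T) V'"
    "tensor_function S T U' V' a'" "tensor_function S T U' V' c'"
    "W' = {p \<in> U' \<times> V'. c' p \<noteq> 0}" "\<forall>q\<in>W'. g q = a' q / c' q"
    using assms(2) by (rule tensor_quotientE)
  have o: "openin (zariski S) (U \<inter> U')" "openin (zariski T) (V \<inter> V')" using W W' by auto
  show thesis
    by (rule that[OF o, of a c a' c'])
      (use W W' in \<open>auto intro: tensor_function_subset[OF _ o]\<close>)
qed

lemma space_with_functions_product: "space_with_functions (product_space S T)"
proof (rule space_with_functionsI[where F = tensor_quotient])
  fix W f assume "tensor_quotient W f"
  then show "openin (zariski (product_space S T)) W"
    by (auto elim!: tensor_quotientE intro: openin_product_spaceI)
next
  fix W f g assume q: "tensor_quotient W f" and eq: "\<And>x. x \<in> W \<Longrightarrow> g x = f x"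
  show "tensor_quotient W g"
    by (rule tensor_quotientE[OF q], rule tensor_quotientI) (use eq in auto)
next
  fix U c x assume "openin (zariski (product_space S T)) U" "x \<in> U"
  then obtain W where W: "W \<in> product_topology_basis S T" "x \<in> W" "W \<subseteq> U"
    unfolding product_space_def
    using openin_topology_generated_by_basis[OF _ _ product_topology_basis_Int, of U x]
    unfolding function_space.simps by metis
  obtain U' V' h where "openin (zariski S) U'" "openin (zariski T) V'" "tensor_function S T U' V' h"
    "W = {p \<in> U' \<times> V'. h p \<noteq> 0}" by (rule product_topology_basisE[OF W(1)])
  \<comment> \<open>The constant is written as \<open>c * h / h\<close>, since the denominator has
    to cut out \<open>W\<close>.\<close>
  then have "tensor_quotient W (\<lambda>_. c)"
    unfolding tensor_quotient_def
    by (intro exI[of _ U'] exI[of _ V'] exI[of _ "\<lambda>p. c * h p"] exI[of _ h])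
      (auto intro: tensor_function_mult tensor_function_const)
  with W show "\<exists>W. x \<in> W \<and> W \<subseteq> U \<and> tensor_quotient W (\<lambda>_. c)" by blast
next
  fix W W' f g assume "tensor_quotient W f" "tensor_quotient W' g"
  then obtain U V a c a' c' where *: "openin (zariski S) U" "openin (zariski T) V"
    "tensor_function S T U V a" "tensor_function S T U V c"
    "tensor_function S T U V a'" "tensor_function S T U V c'"
    "W \<inter> W' = {p \<in> U \<times> V. c p * c' p \<noteq> 0}"
    "\<And>q. q \<in> W \<inter> W' \<Longrightarrow> f q = a q / c q \<and> g q = a' q / c' q"
    by (rule tensor_quotient_common) blast
  note tf = tensor_function_mult[OF _ _ *(1,2)]
  have nz: "c q \<noteq> 0" "c' q \<noteq> 0" if "q \<in> W \<inter> W'" for q using that unfolding *(7) by auto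
  show "tensor_quotient (W \<inter> W') (\<lambda>x. f x + g x)"
    unfolding tensor_quotient_def
    by (intro exI[of _ U] exI[of _ V] exI[of _ "\<lambda>p. a p * c' p + a' p * c p"] exI[of _ "\<lambda>p. c p * c' p"]
        conjI ballI tensor_function_add tf *(1-7))
      (use *(8) nz in \<open>simp add: add_frac_eq\<close>)
  show "tensor_quotient (W \<inter> W') (\<lambda>x. f x * g x)"
    unfolding tensor_quotient_def
    by (intro exI[of _ U] exI[of _ V] exI[of _ "\<lambda>p. a p * a' p"] exI[of _ "\<lambda>p. c p * c' p"]
        conjI ballI tf *(1-7))
      (use *(8) in simp)
next
  fix W f assume "tensor_quotient W f"
  then obtain U V a c where W: "openin (zariski S) U" "openin (zariski T) V"
    "tensor_function S T U V a" "tensor_function S T U V c"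
    "W = {p \<in> U \<times> V. c p \<noteq> 0}" "\<forall>q\<in>W. f q = a q / c q"
    by (rule tensor_quotientE)
  have a: "a q = c q * f q" "c q \<noteq> 0" if "q \<in> W" for q using W(5,6) that by auto
  \<comment> \<open>The inverse of \<open>a / c\<close> is written as \<open>c * c / (a * c)\<close>
    instead of \<open>c / a\<close>: the denominator must also vanish on the part of the rectangle
    outside \<open>W\<close>, so it retains the factor \<open>c\<close>.\<close>
  show "tensor_quotient {x \<in> W. f x \<noteq> 0} (\<lambda>x. inverse (f x))"
  proof (rule tensor_quotientI[of U V "\<lambda>p. c p * c p" "\<lambda>p. a p * c p"])
    show "{x \<in> W. f x \<noteq> 0} = {p \<in> U \<times> V. a p * c p \<noteq> 0}"
    proof (rule Set.set_eqI)
      fix q show "q \<in> {x \<in> W. f x \<noteq> 0} \<longleftrightarrow> q \<in> {p \<in> U \<times> V. a p * c p \<noteq> 0}"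
      proof (cases "q \<in> W")
        case True
        moreover from True have "q \<in> U \<times> V" using W(5) by blast
        ultimately show ?thesis using a[OF True] by simp
      next
        case False
        then show ?thesis unfolding W(5) by auto
      qed
    qed
    show "inverse (f q) = c q * c q / (a q * c q)" if "q \<in> {x \<in> W. f x \<noteq> 0}" for q
      using a[of q] that by (simp add: field_simps)
  qed (intro tensor_function_mult W(1-4))+
qed (rule regular_product_space_iff)

lemma morphism_fst: "morphism (product_space S T) S fst"
  unfolding morphism_def
proof (intro conjI allI impI)
  have eq: "{p \<in> points (product_space S T). fst p \<in> U} = U \<times> points T" if "openin (zariski S) U" for U
    using openin_subset[OF that] by (auto simp: points_product_space)
  have o: "openin (zariski (product_space S T)) (U \<times> points T)" if "openin (zariski S) U" for U
    using openin_product_spaceI[OF that _ tensor_function_const[OF that, of _ 1], of "points T"] by simp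
  show "continuous_map (zariski (product_space S T)) (zariski S) fst"
    unfolding continuous_map_def Pi_iff using eq o
    by (simp add: points_product_space mem_Times_iff)
  fix U f assume r: "regular S U f"
  then have U: "openin (zariski S) U" by (rule S.regular_open)
  have "tensor_function S T U (points T) (\<lambda>p. f (fst p))"
    using tensor_function_regular[OF r T.regular_const[of "points T" 1]] by (simp add: case_prod_unfold)
  then have "tensor_quotient (U \<times> points T) (f \<circ> fst)"
    unfolding tensor_quotient_def
    by (intro exI[of _ U] exI[of _ "points T"] exI[of _ "\<lambda>p. f (fst p)"] exI[of _ "\<lambda>_. 1"])
      (auto intro: U tensor_function_const)
  then show "regular (product_space S T) {p \<in> points (product_space S T). fst p \<in> U} (f \<circ> fst)"
    unfolding eq[OF U] regular_product_space_iff using o[OF U] by (intro conjI ballI) auto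
qed

lemma morphism_snd: "morphism (product_space S T) T snd"
  unfolding morphism_def
proof (intro conjI allI impI)
  have eq: "{p \<in> points (product_space S T). snd p \<in> V} = points S \<times> V" if "openin (zariski T) V" for V
    using openin_subset[OF that] by (auto simp: points_product_space)
  have o: "openin (zariski (product_space S T)) (points S \<times> V)" if "openin (zariski T) V" for V
    using openin_product_spaceI[OF _ that tensor_function_const[OF _ that, of _ 1], of "points S"] by simp
  show "continuous_map (zariski (product_space S T)) (zariski T) snd"
    unfolding continuous_map_def Pi_iff using eq o
    by (simp add: points_product_space mem_Times_iff)
  fix V f assume r: "regular T V f"
  then have V: "openin (zariski T) V" by (rule T.regular_open)
  have "tensor_function S T (points S) V (\<lambda>p. f (snd p))"
    using tensor_function_regular[OF S.regular_const[of "points S" 1] r] by (simp add: case_prod_unfold)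
  then have "tensor_quotient (points S \<times> V) (f \<circ> snd)"
    unfolding tensor_quotient_def
    by (intro exI[of _ "points S"] exI[of _ V] exI[of _ "\<lambda>p. f (snd p)"] exI[of _ "\<lambda>_. 1"])
      (auto intro: V tensor_function_const)
  then show "regular (product_space S T) {p \<in> points (product_space S T). snd p \<in> V} (f \<circ> snd)"
    unfolding eq[OF V] regular_product_space_iff using o[OF V] by (intro conjI ballI) auto
qed

text \<open>Together with the projections this is the universal property of the product. A tensor
  function pulls back to a sum of products of regular functions; its nonvanishing set gives
  continuity, and quotients of such pullbacks give regularity.\<close>

lemma morphism_pair:
  assumes R: "space_with_functions R" and a: "morphism R S a" and b: "morphism R T b"
  shows "morphism R (product_space S T) (\<lambda>x. (a x, b x))"
proof -
  interpret R: space_with_functions R by (rule R)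
  have reg: "regular R {x \<in> points R. a x \<in> U \<and> b x \<in> V} (\<lambda>x. h (a x, b x))"
    if U: "openin (zariski S) U" and V: "openin (zariski T) V" and h: "tensor_function S T U V h" for U V h
  proof -
    let ?W = "{x \<in> points R. a x \<in> U \<and> b x \<in> V}"
    have "?W = {x \<in> points R. a x \<in> U} \<inter> {x \<in> points R. b x \<in> V}" by auto
    then have W: "openin (zariski R) ?W" using morphism_open[OF a U] morphism_open[OF b V] by auto
    obtain n f g where n: "\<And>i. i < n \<Longrightarrow> regular S U (f i) \<and> regular T V (g i)" "h = tensor_sum n f g"
      using h unfolding tensor_function_def by blast
    have "regular R ?W (\<lambda>x. f i (a x))" if "i < n" for i
      by (rule R.regular_subset[OF morphism_regular[OF a] W]) (use n(1)[OF that] in auto)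
    moreover have "regular R ?W (\<lambda>x. g i (b x))" if "i < n" for i
      by (rule R.regular_subset[OF morphism_regular[OF b] W]) (use n(1)[OF that] in auto)
    ultimately show ?thesis unfolding n(2) tensor_sum_def
      by (auto intro!: R.regular_sum R.regular_mult W)
  qed
  have open': "openin (zariski R) {x \<in> points R. (a x, b x) \<in> W}"
    if W0: "W \<in> product_topology_basis S T" for W
  proof -
    obtain U V h where W: "openin (zariski S) U" "openin (zariski T) V" "tensor_function S T U V h"
      "W = {p \<in> U \<times> V. h p \<noteq> 0}" using W0 by (rule product_topology_basisE)
    have "{x \<in> points R. (a x, b x) \<in> W} =
        {x \<in> {x \<in> points R. a x \<in> U \<and> b x \<in> V}. h (a x, b x) \<noteq> 0}" using W(4) by auto
    then show ?thesis using R.nonvanishing_open[OF reg[OF W(1-3)]] by simp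
  qed
  show ?thesis unfolding morphism_def
  proof (intro conjI allI impI)
    have "continuous_map (zariski R) (topology_generated_by (product_topology_basis S T)) (\<lambda>x. (a x, b x))"
    proof (rule continuous_on_generated_topo)
      fix W assume "W \<in> product_topology_basis S T"
      moreover have "(\<lambda>x. (a x, b x)) -` W \<inter> points R = {x \<in> points R. (a x, b x) \<in> W}" by auto
      ultimately show "openin (zariski R) ((\<lambda>x. (a x, b x)) -` W \<inter> points R)" using open' by simp
    next
      show "(\<lambda>x. (a x, b x)) ` points R \<subseteq> \<Union>(product_topology_basis S T)"
        using morphism_points[OF a] morphism_points[OF b] points_product_space
        unfolding product_space_def by (auto simp: topology_generated_by_topspace)
    qed
    then show "continuous_map (zariski R) (zariski (product_space S T)) (\<lambda>x. (a x, b x))"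
      unfolding product_space_def by simp
    fix W h assume r: "regular (product_space S T) W h"
    show "regular R {x \<in> points R. (a x, b x) \<in> W} (h \<circ> (\<lambda>x. (a x, b x)))"
    proof (rule R.regular_local)
      fix x assume x: "x \<in> {x \<in> points R. (a x, b x) \<in> W}"
      then obtain W' where W': "(a x, b x) \<in> W'" "W' \<subseteq> W" "tensor_quotient W' h"
        using r unfolding regular_product_space_iff by blast
      from W'(3) obtain U V p q where U: "openin (zariski S) U" "openin (zariski T) V"
        "tensor_function S T U V p" "tensor_function S T U V q"
        "W' = {p \<in> U \<times> V. q p \<noteq> 0}" "\<forall>z\<in>W'. h z = p z / q z"
        by (rule tensor_quotientE)
      let ?W = "{x \<in> points R. a x \<in> U \<and> b x \<in> V}"
      let ?D = "{x \<in> ?W. q (a x, b x) \<noteq> 0}"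
      have D: "openin (zariski R) ?D" using R.nonvanishing_open[OF reg[OF U(1,2,4)]] .
      have "regular R ?D (\<lambda>x. p (a x, b x) / q (a x, b x))"
        using R.regular_subset[OF reg[OF U(1,2,3)] D] R.regular_subset[OF reg[OF U(1,2,4)] D]
        by (auto intro!: R.regular_divide)
      then have "regular R ?D (h \<circ> (\<lambda>x. (a x, b x)))"
        by (rule R.regular_cong) (use U(5,6) in auto)
      then show "\<exists>V. x \<in> V \<and> V \<subseteq> {x \<in> points R. (a x, b x) \<in> W} \<and>
          regular R V (h \<circ> (\<lambda>x. (a x, b x)))"
        using x W' U(5) by (intro exI[of _ ?D]) auto
    qed
  qed
qed

end

lemma morphism_const:
  assumes "space_with_functions R" "space_with_functions S" "y \<in> points S"
  shows "morphism R S (\<lambda>_. y)"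
proof -
  interpret R: space_with_functions R by fact
  interpret S: space_with_functions S by fact
  show ?thesis unfolding morphism_def
  proof (intro conjI allI impI)
    show "continuous_map (zariski R) (zariski S) (\<lambda>_. y)" using assms(3) by simp
    fix V f
    have "openin (zariski R) {x \<in> points R. y \<in> V}" by (cases "y \<in> V") simp_all
    then show "regular R {x \<in> points R. y \<in> V} (f \<circ> (\<lambda>_. y))"
      unfolding comp_def by (rule R.regular_const)
  qed
qed

section \<open>Polynomials, affine space and projective space as spaces with functions\<close>

section \<open>Polynomial functions and forms\<close>

text \<open>Common form of polynomial functions and of forms: \<open>E\<close> prescribes the
  allowed exponents, either all of them or those of total degree \<open>d\<close>. Closure under
  sums and products is then proved once.\<close>

definition monomial_sum :: "nat \<Rightarrow> (nat \<Rightarrow> nat) set \<Rightarrow> ((nat \<Rightarrow> 'k :: field) \<Rightarrow> 'k) \<Rightarrow> bool" where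
  "monomial_sum n E p \<longleftrightarrow>
     (\<exists>M c. finite M \<and> M \<subseteq> E \<and> p = (\<lambda>x. \<Sum>m\<in>M. c m * (\<Prod>i<n. x i ^ m i)))"

lemma polynomial_function_iff: "polynomial_function n p \<longleftrightarrow> monomial_sum n UNIV p"
  unfolding polynomial_function_def monomial_sum_def by simp

lemma homogeneous_form_iff: "homogeneous_form n d p \<longleftrightarrow> monomial_sum n {m. (\<Sum>i<n. m i) = d} p"
  unfolding homogeneous_form_def monomial_sum_def by (simp add: subset_eq)

text \<open>In \<open>monomial_sum\<close> the terms are indexed by their exponents, whereas sums
  and products produce families in which an exponent may repeat. The coefficients of equal exponents
  are collected over the fibres of \<open>m\<close>.\<close>

lemma monomial_sumI:
  fixes c :: "'i \<Rightarrow> 'k :: field"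
  assumes "finite I" "\<And>i. i \<in> I \<Longrightarrow> m i \<in> E"
  shows "monomial_sum n E (\<lambda>x. \<Sum>i\<in>I. c i * (\<Prod>j<n. x j ^ m i j))"
proof -
  have "(\<Sum>i\<in>I. c i * (\<Prod>j<n. x j ^ m i j)) =
      (\<Sum>e\<in>m ` I. (\<Sum>i\<in>{i \<in> I. m i = e}. c i) * (\<Prod>j<n. x j ^ e j))" for x :: "nat \<Rightarrow> 'k"
    unfolding sum.image_gen[OF assms(1), of _ m] sum_distrib_right by (intro sum.cong) auto
  then show ?thesis unfolding monomial_sum_def
    using assms by (intro exI[of _ "m ` I"] exI[of _ "\<lambda>e. \<Sum>i\<in>{i \<in> I. m i = e}. c i"]) auto
qed

lemma monomial_sum_add:
  assumes "monomial_sum n E p" "monomial_sum n E q"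
  shows "monomial_sum n E (\<lambda>x. p x + q x)"
proof -
  obtain M c where p: "finite M" "M \<subseteq> E" "p = (\<lambda>x. \<Sum>m\<in>M. c m * (\<Prod>i<n. x i ^ m i))"
    using assms(1) unfolding monomial_sum_def by blast
  obtain N d where q: "finite N" "N \<subseteq> E" "q = (\<lambda>x. \<Sum>m\<in>N. d m * (\<Prod>i<n. x i ^ m i))"
    using assms(2) unfolding monomial_sum_def by blast
  \<comment> \<open>The disjoint sum keeps an exponent that occurs in both \<open>M\<close> and
    \<open>N\<close> as two terms, which \<open>monomial_sumI\<close> merges.\<close>
  have "monomial_sum n E
      (\<lambda>x. \<Sum>i\<in>M <+> N. case_sum c d i * (\<Prod>j<n. x j ^ case_sum (\<lambda>m. m) (\<lambda>m. m) i j))"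
    by (rule monomial_sumI) (use p q in auto)
  then show ?thesis unfolding p(3) q(3) by (simp add: sum.Plus p(1) q(1))
qed

lemma monomial_sum_mult:
  assumes "monomial_sum n E p" "monomial_sum n E' q"
    and "\<And>m m'. \<lbrakk>m \<in> E; m' \<in> E'\<rbrakk> \<Longrightarrow> (\<lambda>i. m i + m' i) \<in> E''"
  shows "monomial_sum n E'' (\<lambda>x. p x * q x)"
proof -
  obtain M c where p: "finite M" "M \<subseteq> E" "p = (\<lambda>x. \<Sum>m\<in>M. c m * (\<Prod>i<n. x i ^ m i))"
    using assms(1) unfolding monomial_sum_def by blast
  obtain N d where q: "finite N" "N \<subseteq> E'" "q = (\<lambda>x. \<Sum>m\<in>N. d m * (\<Prod>i<n. x i ^ m i))"
    using assms(2) unfolding monomial_sum_def by blast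
  have "monomial_sum n E''
      (\<lambda>x. \<Sum>i\<in>M \<times> N. (c (fst i) * d (snd i)) * (\<Prod>j<n. x j ^ (\<lambda>j. fst i j + snd i j) j))"
    by (rule monomial_sumI) (use p(1,2) q(1,2) in \<open>auto intro!: assms(3)\<close>)
  then show ?thesis unfolding p(3) q(3) sum_product sum.cartesian_product
    by (simp add: case_prod_unfold power_add prod.distrib mult_ac)
qed

lemma monomial_sum_const:
  assumes "(\<lambda>_. 0) \<in> E" shows "monomial_sum n E (\<lambda>_. c)"
  using monomial_sumI[of "{()}" "\<lambda>_ _. 0" E n "\<lambda>_. c"] assms by simp

lemma monomial_sum_coordinate:
  assumes "i < n" "(\<lambda>j. if j = i then 1 else 0) \<in> E" shows "monomial_sum n E (\<lambda>x. x i)"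
proof -
  have "(\<Prod>j<n. x j ^ (if j = i then 1 else 0)) = x i" for x :: "nat \<Rightarrow> 'a"
  proof -
    have "(\<Prod>j<n. x j ^ (if j = i then 1 else 0)) = (\<Prod>j<n. if j = i then x j else 1)"
      by (rule prod.cong) auto
    then show ?thesis using assms(1) by simp
  qed
  moreover have "monomial_sum n E (\<lambda>x. \<Sum>i'\<in>{()}. (1 :: 'a) * (\<Prod>j<n. x j ^ (if j = i then 1 else 0)))"
    by (rule monomial_sumI) (use assms(2) in auto)
  ultimately show ?thesis by (simp only: sum.insert_if sum.empty finite.emptyI empty_iff if_False mult_1_left add_0_right)
qed

lemma polynomial_function_const: "polynomial_function n (\<lambda>_. c)"
  and polynomial_function_coordinate: "i < n \<Longrightarrow> polynomial_function n (\<lambda>x. x i)"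
  and polynomial_function_add:
    "\<lbrakk>polynomial_function n p; polynomial_function n q\<rbrakk> \<Longrightarrow> polynomial_function n (\<lambda>x. p x + q x)"
  and polynomial_function_mult:
    "\<lbrakk>polynomial_function n p; polynomial_function n q\<rbrakk> \<Longrightarrow> polynomial_function n (\<lambda>x. p x * q x)"
  unfolding polynomial_function_iff
  by (auto intro: monomial_sum_const monomial_sum_coordinate monomial_sum_add monomial_sum_mult)

lemma homogeneous_form_const: "homogeneous_form n 0 (\<lambda>_. c)"
  and homogeneous_form_coordinate: "i < n \<Longrightarrow> homogeneous_form n 1 (\<lambda>x. x i)"
  and homogeneous_form_add:
    "\<lbrakk>homogeneous_form n d p; homogeneous_form n d q\<rbrakk> \<Longrightarrow> homogeneous_form n d (\<lambda>x. p x + q x)"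
  and homogeneous_form_mult:
    "\<lbrakk>homogeneous_form n d p; homogeneous_form n e q\<rbrakk> \<Longrightarrow> homogeneous_form n (d + e) (\<lambda>x. p x * q x)"
  unfolding homogeneous_form_iff
  by (auto intro!: monomial_sum_const monomial_sum_coordinate monomial_sum_add
      intro: monomial_sum_mult simp: sum.distrib)

lemma homogeneous_form_imp_polynomial_function:
  "homogeneous_form n d p \<Longrightarrow> polynomial_function n p"
  unfolding homogeneous_form_def polynomial_function_def by blast

lemma homogeneous_form_scale:
  assumes "homogeneous_form n d p" shows "p (\<lambda>i. c * v i) = c ^ d * p v"
proof -
  obtain M b where p: "\<forall>m\<in>M. (\<Sum>i<n. m i) = d" "p = (\<lambda>x. \<Sum>m\<in>M. b m * (\<Prod>i<n. x i ^ m i))"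
    using assms unfolding homogeneous_form_def by blast
  have "(\<Prod>i<n. (c * v i) ^ m i) = c ^ d * (\<Prod>i<n. v i ^ m i)" if "m \<in> M" for m
    using p(1) that by (auto simp: power_mult_distrib prod.distrib power_sum[symmetric])
  then show ?thesis unfolding p(2) sum_distrib_left by (intro sum.cong) auto
qed

text \<open>Passage to univariate polynomials, whose roots, degrees and derivatives drive the later
  arguments. With a single variable, only \<open>x 0\<close> and the exponent \<open>m 0\<close> are
  visible.\<close>

lemma polynomial_function_1_poly:
  assumes "polynomial_function 1 p"
  obtains P :: "'k :: field poly" where "\<And>x. p x = poly P (x 0)"
proof -
  obtain M c where p: "p = (\<lambda>x. \<Sum>m\<in>M. c m * (\<Prod>i<1. x i ^ m i))"
    using assms unfolding polynomial_function_def by blast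
  have "p x = poly (\<Sum>m\<in>M. Polynomial.monom (c m) (m 0)) (x 0)" for x
    unfolding p by (simp add: poly_sum poly_monom)
  then show thesis by (rule that)
qed

section \<open>Affine space\<close>

lemma topspace_affine: "topspace (affine_topology n) = (coordinate_space n :: (nat \<Rightarrow> 'k :: field) set)"
proof -
  have "(coordinate_space n :: (nat \<Rightarrow> 'k) set) \<subseteq> \<Union>{{x \<in> coordinate_space n. p x \<noteq> 0} |p. polynomial_function n p}"
  proof
    fix x :: "nat \<Rightarrow> 'k" assume x: "x \<in> coordinate_space n"
    then have "x \<in> {x \<in> coordinate_space n. (\<lambda>_. 1 :: 'k) x \<noteq> 0}" by simp
    then show "x \<in> \<Union>{{x \<in> coordinate_space n. p x \<noteq> 0} |p. polynomial_function n p}"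
      using polynomial_function_const[of n "1 :: 'k"] by blast
  qed
  then show ?thesis unfolding affine_topology_def topology_generated_by_topspace by blast
qed

lemma points_affine_space: "points (affine_space n) = coordinate_space n"
  unfolding affine_space_def by (simp add: topspace_affine)

lemma openin_affine_nonvanishing:
  "polynomial_function n p \<Longrightarrow> openin (zariski (affine_space n)) {x \<in> coordinate_space n. p x \<noteq> 0}"
  unfolding affine_space_def affine_topology_def function_space.simps
  by (rule topology_generated_by_Basis) blast

definition affine_quotient :: "nat \<Rightarrow> (nat \<Rightarrow> 'k :: alg_closed_field) set \<Rightarrow> ((nat \<Rightarrow> 'k) \<Rightarrow> 'k) \<Rightarrow> bool" where
  "affine_quotient n V f \<longleftrightarrow> openin (zariski (affine_space n)) V \<and>
     (\<exists>p q. polynomial_function n p \<and> polynomial_function n q \<and> (\<forall>y\<in>V. q y \<noteq> 0 \<and> f y = p y / q y))"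

lemma affine_quotientI:
  assumes "openin (zariski (affine_space n)) V" "polynomial_function n p" "polynomial_function n q"
    "\<And>y. y \<in> V \<Longrightarrow> q y \<noteq> 0" "\<And>y. y \<in> V \<Longrightarrow> f y = p y / q y"
  shows "affine_quotient n V f"
  unfolding affine_quotient_def using assms by blast

lemma regular_affine_space_iff:
  "regular (affine_space n) U f \<longleftrightarrow> openin (zariski (affine_space n)) U \<and>
     (\<forall>x\<in>U. \<exists>V. x \<in> V \<and> V \<subseteq> U \<and> affine_quotient n V f)"
  unfolding affine_quotient_def affine_space_def function_space.simps
  by (intro conj_cong ball_cong refl) blast

lemma space_with_functions_affine: "space_with_functions (affine_space n)"
proof (rule space_with_functionsI[where F = "affine_quotient n"])
  fix W W' :: "(nat \<Rightarrow> 'a) set" and f g assume "affine_quotient n W f" "affine_quotient n W' g"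
  then obtain p q p' q' where *: "openin (zariski (affine_space n)) W" "openin (zariski (affine_space n)) W'"
    "polynomial_function n p" "polynomial_function n q" "\<forall>y\<in>W. q y \<noteq> 0 \<and> f y = p y / q y"
    "polynomial_function n p'" "polynomial_function n q'" "\<forall>y\<in>W'. q' y \<noteq> 0 \<and> g y = p' y / q' y"
    unfolding affine_quotient_def by blast
  show "affine_quotient n (W \<inter> W') (\<lambda>x. f x + g x)"
    by (rule affine_quotientI[of n _ "\<lambda>x. p x * q' x + p' x * q x" "\<lambda>x. q x * q' x"],
        (intro polynomial_function_add polynomial_function_mult openin_Int *)+)
      (use * in \<open>auto simp: add_frac_eq\<close>)
  show "affine_quotient n (W \<inter> W') (\<lambda>x. f x * g x)"
    by (rule affine_quotientI[of n _ "\<lambda>x. p x * p' x" "\<lambda>x. q x * q' x"],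
        (intro polynomial_function_mult openin_Int *)+)
      (use * in auto)
next
  fix W :: "(nat \<Rightarrow> 'a) set" and f assume "affine_quotient n W f"
  then obtain p q where *: "openin (zariski (affine_space n)) W"
    "polynomial_function n p" "polynomial_function n q" "\<forall>y\<in>W. q y \<noteq> 0 \<and> f y = p y / q y"
    unfolding affine_quotient_def by blast
  have "W \<subseteq> coordinate_space n" using openin_subset[OF *(1)] by (simp add: points_affine_space)
  then have eq: "{x \<in> W. f x \<noteq> 0} = W \<inter> {x \<in> coordinate_space n. p x \<noteq> 0}" using *(4) by auto
  have "openin (zariski (affine_space n)) {x \<in> W. f x \<noteq> 0}"
    unfolding eq by (intro openin_Int * openin_affine_nonvanishing)
  then show "affine_quotient n {x \<in> W. f x \<noteq> 0} (\<lambda>x. inverse (f x))"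
    by (rule affine_quotientI[of n _ q p]) (use * in auto)
next
  fix U :: "(nat \<Rightarrow> 'a) set" and c x assume U: "openin (zariski (affine_space n)) U" "x \<in> U"
  have "affine_quotient n U (\<lambda>_. c)"
    by (rule affine_quotientI[of n _ "\<lambda>_. c" "\<lambda>_. 1"]) (auto intro: U polynomial_function_const)
  with U show "\<exists>W. x \<in> W \<and> W \<subseteq> U \<and> affine_quotient n W (\<lambda>_. c)" by blast
qed (rule regular_affine_space_iff, auto simp: affine_quotient_def)

lemma regular_affine_polynomial:
  assumes "polynomial_function n p" "openin (zariski (affine_space n)) U"
  shows "regular (affine_space n) U p"
proof -
  have "affine_quotient n U p"
    by (rule affine_quotientI[of n _ p "\<lambda>_. 1"]) (auto intro: assms polynomial_function_const)
  with assms(2) show ?thesis unfolding regular_affine_space_iff by blast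
qed

text \<open>Polynomials in regular functions are regular. Hence a basic open set pulls back to a
  nonvanishing set, and a quotient of polynomials to a quotient of regular functions; checking the
  coordinates is enough.\<close>

lemma morphism_affine_space:
  fixes S :: "('a, 'k :: alg_closed_field) function_space"
  assumes S: "space_with_functions S"
    and h: "\<And>x. x \<in> points S \<Longrightarrow> h x \<in> coordinate_space n"
    and reg: "\<And>i. i < n \<Longrightarrow> regular S (points S) (\<lambda>x. h x i)"
  shows "morphism S (affine_space n) h"
proof -
  interpret space_with_functions S by (rule S)
  have polynomial: "regular S (points S) (\<lambda>x. p (h x))" if "polynomial_function n p" for p
    by (rule regular_polynomial[OF that reg openin_topspace])
  have cont: "continuous_map (zariski S) (zariski (affine_space n)) h"
    unfolding affine_space_def affine_topology_def function_space.simps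
  proof (rule continuous_on_generated_topo)
    fix U :: "(nat \<Rightarrow> 'k) set" assume "U \<in> {{x \<in> coordinate_space n. p x \<noteq> 0} |p. polynomial_function n p}"
    then obtain p where p: "U = {x \<in> coordinate_space n. p x \<noteq> 0}" "polynomial_function n p" by blast
    have "h -` U \<inter> points S = {x \<in> points S. p (h x) \<noteq> 0}" using p(1) h by auto
    then show "openin (zariski S) (h -` U \<inter> points S)"
      using nonvanishing_open[OF polynomial[OF p(2)]] by simp
  next
    have "\<Union>{{x \<in> coordinate_space n. p x \<noteq> 0} |p. polynomial_function n p} = (coordinate_space n :: (nat \<Rightarrow> 'k) set)"
      using topspace_affine[of n, where ?'k = 'k] unfolding affine_topology_def topology_generated_by_topspace .
    then show "h ` points S \<subseteq> \<Union>{{x \<in> coordinate_space n. p x \<noteq> 0} |p. polynomial_function n p}"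
      using h by auto
  qed
  show ?thesis unfolding morphism_def
  proof (intro conjI allI impI cont regular_local)
    fix V f x assume r: "regular (affine_space n) V f" and x: "x \<in> {x \<in> points S. h x \<in> V}"
    then obtain V' where V': "h x \<in> V'" "V' \<subseteq> V" "affine_quotient n V' f"
      unfolding regular_affine_space_iff by blast
    then obtain p q where pq: "openin (zariski (affine_space n)) V'"
      "polynomial_function n p" "polynomial_function n q" "\<And>y. y \<in> V' \<Longrightarrow> q y \<noteq> 0 \<and> f y = p y / q y"
      unfolding affine_quotient_def by blast
    let ?W = "{x \<in> points S. h x \<in> V'}"
    have W: "openin (zariski S) ?W" using cont pq(1) unfolding continuous_map_def by blast
    have "regular S ?W (\<lambda>x. p (h x) / q (h x))"
      by (intro regular_divide regular_subset[OF polynomial W] pq(2,3)) (use pq(4) in auto)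
    then have "regular S ?W (f \<circ> h)" by (rule regular_cong) (use pq(4) in auto)
    then show "\<exists>W. x \<in> W \<and> W \<subseteq> {x \<in> points S. h x \<in> V} \<and> regular S W (f \<circ> h)"
      using x V' by (intro exI[of _ ?W]) auto
  qed
qed

section \<open>Projective space\<close>

definition line :: "(nat \<Rightarrow> 'k :: field) \<Rightarrow> (nat \<Rightarrow> 'k) set" where
  "line v = {(\<lambda>i. c * v i) | c. True}"

lemma line_self: "v \<in> line v"
  unfolding line_def by (rule CollectI, rule exI[of _ 1]) simp

lemma mem_line_iff: "w \<in> line v \<longleftrightarrow> (\<exists>c. w = (\<lambda>i. c * v i))"
  unfolding line_def by blast

lemma line_scale:
  assumes "c \<noteq> 0" shows "line (\<lambda>i. c * v i) = line v"
proof
  show "line (\<lambda>i. c * v i) \<subseteq> line v" unfolding line_def by (auto simp: mult.assoc[symmetric])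
  show "line v \<subseteq> line (\<lambda>i. c * v i)"
  proof
    fix w assume "w \<in> line v"
    then obtain d where "w = (\<lambda>i. d * v i)" unfolding line_def by blast
    then have "w = (\<lambda>i. (d / c) * (c * v i))" using assms by simp
    then show "w \<in> line (\<lambda>i. c * v i)" unfolding mem_line_iff by blast
  qed
qed

lemma line_eqD: "line v = line w \<Longrightarrow> \<exists>c. v = (\<lambda>i. c * w i)"
  using line_self mem_line_iff by metis

lemma projective_points_iff:
  "L \<in> projective_points n \<longleftrightarrow> (\<exists>v. v \<in> coordinate_space (Suc n) \<and> v \<noteq> (\<lambda>_. 0) \<and> L = line v)"
  unfolding projective_points_def line_def by blast

lemma projective_pointE:
  assumes "L \<in> projective_points n"
  obtains v where "v \<in> coordinate_space (Suc n)" "v \<noteq> (\<lambda>_. 0)" "L = line v"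
  using assms unfolding projective_points_iff by blast

text \<open>Scaling a vector by \<open>c\<close> multiplies the form by \<open>c ^ d\<close>, so one
  representative decides the condition that the projective topology imposes on all nonzero vectors
  of a line.\<close>

lemma homogeneous_form_line_nonzero:
  assumes "homogeneous_form m d p" "v \<noteq> (\<lambda>_. 0)"
  shows "(\<forall>w\<in>line v - {\<lambda>_. 0}. p w \<noteq> 0) \<longleftrightarrow> p v \<noteq> 0"
proof
  assume "\<forall>w\<in>line v - {\<lambda>_. 0}. p w \<noteq> 0" then show "p v \<noteq> 0" using assms(2) line_self by blast
next
  assume p: "p v \<noteq> 0"
  show "\<forall>w\<in>line v - {\<lambda>_. 0}. p w \<noteq> 0"
  proof
    fix w assume w: "w \<in> line v - {\<lambda>_. 0}"
    then obtain c where c: "w = (\<lambda>i. c * v i)" unfolding line_def by blast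
    with w have "c \<noteq> 0" by auto
    with p show "p w \<noteq> 0" unfolding c homogeneous_form_scale[OF assms(1)] by simp
  qed
qed

lemma topspace_projective: "topspace (projective_topology n) = (projective_points n :: (nat \<Rightarrow> 'k :: field) set set)"
proof -
  have "{L \<in> projective_points n. \<forall>v\<in>L - {\<lambda>_. 0}. (\<lambda>_. 1 :: 'k) v \<noteq> 0} = projective_points n" by simp
  then have "projective_points n \<in> {{L \<in> projective_points n. \<forall>v\<in>L - {\<lambda>_. 0}. p v \<noteq> (0 :: 'k)} |p d. homogeneous_form (Suc n) d p}"
    using homogeneous_form_const[of "Suc n" "1 :: 'k"]
    by (intro CollectI exI[of _ "\<lambda>_. 1 :: 'k"] exI[of _ "0 :: nat"] conjI) simp_all
  then show ?thesis unfolding projective_topology_def topology_generated_by_topspace by blast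
qed

lemma points_projective_space: "points (projective_space n) = projective_points n"
  unfolding projective_space_def by (simp add: topspace_projective)

lemma openin_projective_nonvanishing:
  "homogeneous_form (Suc n) d p \<Longrightarrow>
     openin (zariski (projective_space n)) {L \<in> projective_points n. \<forall>v\<in>L - {\<lambda>_. 0}. p v \<noteq> 0}"
  unfolding projective_space_def projective_topology_def function_space.simps
  by (rule topology_generated_by_Basis) blast

definition projective_quotient ::
  "nat \<Rightarrow> (nat \<Rightarrow> 'k :: alg_closed_field) set set \<Rightarrow> ((nat \<Rightarrow> 'k) set \<Rightarrow> 'k) \<Rightarrow> bool" where
  "projective_quotient n V f \<longleftrightarrow> openin (zariski (projective_space n)) V \<and>
     (\<exists>d p q. homogeneous_form (Suc n) d p \<and> homogeneous_form (Suc n) d q \<and>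
        (\<forall>M\<in>V. \<forall>v\<in>M - {\<lambda>_. 0}. q v \<noteq> 0 \<and> f M = p v / q v))"

lemma projective_quotientI:
  assumes "openin (zariski (projective_space n)) V"
    "homogeneous_form (Suc n) d p" "homogeneous_form (Suc n) d q"
    "\<And>L v. \<lbrakk>L \<in> V; v \<in> L - {\<lambda>_. 0}\<rbrakk> \<Longrightarrow> q v \<noteq> 0"
    "\<And>L v. \<lbrakk>L \<in> V; v \<in> L - {\<lambda>_. 0}\<rbrakk> \<Longrightarrow> f L = p v / q v"
  shows "projective_quotient n V f"
  unfolding projective_quotient_def using assms by blast

lemma regular_projective_space_iff:
  "regular (projective_space n) U f \<longleftrightarrow> openin (zariski (projective_space n)) U \<and>
     (\<forall>x\<in>U. \<exists>V. x \<in> V \<and> V \<subseteq> U \<and> projective_quotient n V f)"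
  unfolding projective_quotient_def projective_space_def function_space.simps
  by (intro conj_cong ball_cong refl) blast

lemma space_with_functions_projective: "space_with_functions (projective_space n)"
proof (rule space_with_functionsI[where F = "projective_quotient n"])
  fix W W' :: "(nat \<Rightarrow> 'a) set set" and f g
  assume "projective_quotient n W f" "projective_quotient n W' g"
  then obtain d p q d' p' q' where *:
    "openin (zariski (projective_space n)) W" "openin (zariski (projective_space n)) W'"
    "homogeneous_form (Suc n) d p" "homogeneous_form (Suc n) d q"
    "\<forall>M\<in>W. \<forall>v\<in>M - {\<lambda>_. 0}. q v \<noteq> 0 \<and> f M = p v / q v"
    "homogeneous_form (Suc n) d' p'" "homogeneous_form (Suc n) d' q'"
    "\<forall>M\<in>W'. \<forall>v\<in>M - {\<lambda>_. 0}. q' v \<noteq> 0 \<and> g M = p' v / q' v"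
    unfolding projective_quotient_def by blast
  have hf: "homogeneous_form (Suc n) (d + d') (\<lambda>x. p' x * q x)"
    using homogeneous_form_mult[OF *(6,4)] by (simp add: add.commute)
  show "projective_quotient n (W \<inter> W') (\<lambda>x. f x + g x)"
    by (rule projective_quotientI[of n _ "d + d'" "\<lambda>x. p x * q' x + p' x * q x" "\<lambda>x. q x * q' x"],
        (intro homogeneous_form_add homogeneous_form_mult openin_Int * hf)+)
      (use * in \<open>auto simp: add_frac_eq\<close>)
  show "projective_quotient n (W \<inter> W') (\<lambda>x. f x * g x)"
    by (rule projective_quotientI[of n _ "d + d'" "\<lambda>x. p x * p' x" "\<lambda>x. q x * q' x"],
        (intro homogeneous_form_mult openin_Int *)+)
      (use * in auto)
next
  fix W :: "(nat \<Rightarrow> 'a) set set" and f assume "projective_quotient n W f"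
  then obtain d p q where *: "openin (zariski (projective_space n)) W"
    "homogeneous_form (Suc n) d p" "homogeneous_form (Suc n) d q"
    "\<And>M v. \<lbrakk>M \<in> W; v \<in> M - {\<lambda>_. 0}\<rbrakk> \<Longrightarrow> q v \<noteq> 0 \<and> f M = p v / q v"
    unfolding projective_quotient_def by blast
  have W: "W \<subseteq> projective_points n" using openin_subset[OF *(1)] by (simp add: points_projective_space)
  have eq: "{x \<in> W. f x \<noteq> 0} = W \<inter> {L \<in> projective_points n. \<forall>v\<in>L - {\<lambda>_. 0}. p v \<noteq> 0}"
  proof (rule Set.set_eqI)
    fix L show "L \<in> {x \<in> W. f x \<noteq> 0} \<longleftrightarrow> L \<in> W \<inter> {L \<in> projective_points n. \<forall>v\<in>L - {\<lambda>_. 0}. p v \<noteq> 0}"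
    proof (cases "L \<in> W")
      case True
      then obtain v where v: "v \<in> coordinate_space (Suc n)" "v \<noteq> (\<lambda>_. 0)" "L = line v"
        using W projective_pointE by blast
      then have "q v \<noteq> 0 \<and> f L = p v / q v" using *(4)[OF True, of v] line_self[of v] by simp
      then show ?thesis using True W homogeneous_form_line_nonzero[OF *(2) v(2)] unfolding v(3) by auto
    qed simp
  qed
  have "openin (zariski (projective_space n)) {x \<in> W. f x \<noteq> 0}"
    unfolding eq by (intro openin_Int *(1) openin_projective_nonvanishing[OF *(2)])
  then show "projective_quotient n {x \<in> W. f x \<noteq> 0} (\<lambda>x. inverse (f x))"
  proof (rule projective_quotientI[of n _ d q p, OF _ *(3,2)])
    fix M v assume "M \<in> {x \<in> W. f x \<noteq> 0}" "v \<in> M - {\<lambda>_. 0}"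
    then show "p v \<noteq> 0" "inverse (f M) = q v / p v" using *(4)[of M v] by auto
  qed
next
  fix U :: "(nat \<Rightarrow> 'a) set set" and c x assume U: "openin (zariski (projective_space n)) U" "x \<in> U"
  have "projective_quotient n U (\<lambda>_. c)"
    by (rule projective_quotientI[of n _ 0 "\<lambda>_. c" "\<lambda>_. 1"]) (auto intro: U homogeneous_form_const)
  with U show "\<exists>W. x \<in> W \<and> W \<subseteq> U \<and> projective_quotient n W (\<lambda>_. c)" by blast
qed (rule regular_projective_space_iff, auto simp: projective_quotient_def)

text \<open>Homogeneous coordinates \<open>a\<close> of a map need to exist only locally. Forms
  evaluated at \<open>a\<close> are regular, so basic open sets pull back to nonvanishing sets, and
  a quotient of two forms of equal degree pulls back to a quotient of regular functions.\<close>

lemma morphism_projective_space: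
  fixes S :: "('a, 'k :: alg_closed_field) function_space"
  assumes S: "space_with_functions S"
    and local: "\<And>x. x \<in> points S \<Longrightarrow> \<exists>U a. x \<in> U \<and> openin (zariski S) U \<and> (\<forall>i\<le>n. regular S U (\<lambda>y. a y i)) \<and>
      (\<forall>y\<in>U. a y \<in> coordinate_space (Suc n) \<and> a y \<noteq> (\<lambda>_. 0) \<and> h y = line (a y))"
  shows "morphism S (projective_space n) h"
proof -
  interpret space_with_functions S by (rule S)
  have form: "regular S U (\<lambda>y. p (a y))"
    if "openin (zariski S) U" "\<forall>i\<le>n. regular S U (\<lambda>y. a y i)" "homogeneous_form (Suc n) d p" for U a p d
    by (rule regular_polynomial[OF homogeneous_form_imp_polynomial_function[OF that(3)] _ that(1)])
      (use that(2) in auto)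
  have im: "h x \<in> projective_points n" if "x \<in> points S" for x
    using local[OF that] unfolding projective_points_iff by blast
  have cont: "continuous_map (zariski S) (zariski (projective_space n)) h"
    unfolding projective_space_def projective_topology_def function_space.simps
  proof (rule continuous_on_generated_topo)
    fix V :: "(nat \<Rightarrow> 'k) set set"
    assume "V \<in> {{L \<in> projective_points n. \<forall>v\<in>L - {\<lambda>_. 0}. p v \<noteq> 0} |p d. homogeneous_form (Suc n) d p}"
    then obtain p d where p: "V = {L \<in> projective_points n. \<forall>v\<in>L - {\<lambda>_. 0}. p v \<noteq> 0}"
      "homogeneous_form (Suc n) d p" by blast
    show "openin (zariski S) (h -` V \<inter> points S)"
    proof (subst openin_subopen, rule ballI)
      fix x assume x: "x \<in> h -` V \<inter> points S"
      then obtain U a where U: "x \<in> U" "openin (zariski S) U" "\<forall>i\<le>n. regular S U (\<lambda>y. a y i)"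
        "\<And>y. y \<in> U \<Longrightarrow> a y \<in> coordinate_space (Suc n) \<and> a y \<noteq> (\<lambda>_. 0) \<and> h y = line (a y)"
        using local[of x] by blast
      have mem: "h y \<in> V \<longleftrightarrow> p (a y) \<noteq> 0" if "y \<in> U" for y
        using U(4)[OF that] homogeneous_form_line_nonzero[OF p(2), of "a y"] im[of y]
          openin_subset[OF U(2)] that unfolding p(1) by auto
      have "openin (zariski S) {y \<in> U. p (a y) \<noteq> 0}"
        by (rule nonvanishing_open[OF form[OF U(2,3) p(2)]])
      then show "\<exists>T. openin (zariski S) T \<and> x \<in> T \<and> T \<subseteq> h -` V \<inter> points S"
        using U(1) x mem openin_subset[OF U(2)] by (intro exI[of _ "{y \<in> U. p (a y) \<noteq> 0}"]) auto
    qed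
  next
    have "\<Union>{{L \<in> projective_points n. \<forall>v\<in>L - {\<lambda>_. 0}. p v \<noteq> (0 :: 'k)} |p d. homogeneous_form (Suc n) d p}
        = projective_points n"
      using topspace_projective[of n, where ?'k = 'k]
      unfolding projective_topology_def topology_generated_by_topspace .
    then show "h ` points S \<subseteq>
        \<Union>{{L \<in> projective_points n. \<forall>v\<in>L - {\<lambda>_. 0}. p v \<noteq> 0} |p d. homogeneous_form (Suc n) d p}"
      using im by auto
  qed
  show ?thesis unfolding morphism_def
  proof (intro conjI allI impI cont regular_local)
    fix V f x assume r: "regular (projective_space n) V f" and x: "x \<in> {x \<in> points S. h x \<in> V}"
    then obtain V' where V': "h x \<in> V'" "V' \<subseteq> V" "projective_quotient n V' f"
      unfolding regular_projective_space_iff by blast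
    then obtain d p q where pq: "openin (zariski (projective_space n)) V'"
      "homogeneous_form (Suc n) d p" "homogeneous_form (Suc n) d q"
      "\<And>M v. \<lbrakk>M \<in> V'; v \<in> M - {\<lambda>_. 0}\<rbrakk> \<Longrightarrow> q v \<noteq> 0 \<and> f M = p v / q v"
      unfolding projective_quotient_def by blast
    obtain U a where U: "x \<in> U" "openin (zariski S) U" "\<forall>i\<le>n. regular S U (\<lambda>y. a y i)"
      "\<And>y. y \<in> U \<Longrightarrow> a y \<in> coordinate_space (Suc n) \<and> a y \<noteq> (\<lambda>_. 0) \<and> h y = line (a y)"
      using local[of x] x by blast
    let ?W = "{x \<in> points S. h x \<in> V'} \<inter> U"
    have W: "openin (zariski S) ?W" using cont pq(1) U(2) unfolding continuous_map_def by blast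
    have quot: "q (a y) \<noteq> 0 \<and> f (h y) = p (a y) / q (a y)" if "y \<in> ?W" for y
      using pq(4)[of "h y" "a y"] U(4)[of y] line_self[of "a y"] that by auto
    have "regular S ?W (\<lambda>y. p (a y) / q (a y))"
      by (intro regular_divide regular_subset[OF form[OF U(2,3) pq(2)] W]
          regular_subset[OF form[OF U(2,3) pq(3)] W]) (use quot in auto)
    then have "regular S ?W (f \<circ> h)" by (rule regular_cong) (use quot in auto)
    then show "\<exists>W. x \<in> W \<and> W \<subseteq> {x \<in> points S. h x \<in> V} \<and> regular S W (f \<circ> h)"
      using x V' U(1) by (intro exI[of _ ?W]) auto
  qed
qed

subsection \<open>Standard charts\<close>

definition chart :: "nat \<Rightarrow> nat \<Rightarrow> (nat \<Rightarrow> 'k :: field) set set" where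
  "chart n i = {L \<in> projective_points n. \<forall>v\<in>L - {\<lambda>_. 0}. v i \<noteq> 0}"

text \<open>The affine coordinates on chart \<open>i\<close>, with coordinate \<open>i\<close>,
  equal to 1, kept in place. The chart thereby becomes the hyperplane where coordinate
  \<open>i\<close> is 1 in affine space of one more dimension, without any reindexing. Off the chart
  the value is unspecified.\<close>

definition normalized :: "nat \<Rightarrow> (nat \<Rightarrow> 'k :: field) set \<Rightarrow> nat \<Rightarrow> 'k" where
  "normalized i L = (THE v. v \<in> L \<and> v i = 1)"

lemma normalized_line:
  assumes "v i \<noteq> 0" shows "normalized i (line v) = (\<lambda>j. v j / v i)"
  unfolding normalized_def
proof (rule the_equality)
  have "(\<lambda>j. v j / v i) = (\<lambda>j. inverse (v i) * v j)" by (simp add: field_simps)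
  then show "(\<lambda>j. v j / v i) \<in> line v \<and> v i / v i = 1" using assms unfolding mem_line_iff by auto
next
  fix w assume w: "w \<in> line v \<and> w i = 1"
  then obtain c where "w = (\<lambda>i. c * v i)" unfolding mem_line_iff by blast
  with w assms show "w = (\<lambda>j. v j / v i)" by (auto simp: field_simps fun_eq_iff)
qed

lemma chartE:
  assumes "L \<in> chart n i"
  obtains v where "v \<in> coordinate_space (Suc n)" "v i \<noteq> 0" "L = line v"
proof -
  obtain v where v: "v \<in> coordinate_space (Suc n)" "v \<noteq> (\<lambda>_. 0)" "L = line v"
    using assms projective_pointE unfolding chart_def by blast
  then have "v i \<noteq> 0" using assms line_self unfolding chart_def by blast
  with v that show thesis by blast
qed

lemma line_mem_chart_iff:
  assumes "v \<in> coordinate_space (Suc n)" "v \<noteq> (\<lambda>_. 0)" "i \<le> n"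
  shows "line v \<in> chart n i \<longleftrightarrow> v i \<noteq> 0"
  using homogeneous_form_line_nonzero[OF homogeneous_form_coordinate[of i "Suc n"] assms(2)] assms
  unfolding chart_def projective_points_iff by auto

lemma normalized_chart:
  assumes "L \<in> chart n i"
  shows "normalized i L \<in> coordinate_space (Suc n)" "normalized i L i = 1" "line (normalized i L) = L"
proof -
  obtain v where v: "v \<in> coordinate_space (Suc n)" "v i \<noteq> 0" "L = line v" using assms by (rule chartE)
  note eq = normalized_line[of v i, OF v(2), folded v(3)]
  show "normalized i L \<in> coordinate_space (Suc n)" "normalized i L i = 1"
    unfolding eq using v by (auto simp: coordinate_space_def)
  have "line (\<lambda>j. inverse (v i) * v j) = line v" using v(2) by (intro line_scale) simp
  then show "line (normalized i L) = L" unfolding eq unfolding v(3) by (simp add: field_simps)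
qed

lemma normalized_nonzero: "L \<in> chart n i \<Longrightarrow> normalized i L \<noteq> (\<lambda>_. 0)"
  using normalized_chart(2)[of L n i] by auto

lemma openin_chart: "i \<le> n \<Longrightarrow> openin (zariski (projective_space n)) (chart n i)"
  unfolding chart_def using openin_projective_nonvanishing[OF homogeneous_form_coordinate[of i "Suc n"]] by simp

lemma chart_cover:
  assumes "L \<in> projective_points n" obtains i where "i \<le> n" "L \<in> chart n i"
proof -
  obtain v where v: "v \<in> coordinate_space (Suc n)" "v \<noteq> (\<lambda>_. 0)" "L = line v"
    using assms by (rule projective_pointE)
  then obtain i where "v i \<noteq> 0" by auto
  moreover from this v(1) have "i \<le> n" unfolding coordinate_space_def by (auto simp: not_less_eq_eq)
  ultimately show thesis using that line_mem_chart_iff[OF v(1,2)] v(3) by blast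
qed

lemma regular_normalized:
  assumes "i \<le> n" "j \<le> n"
  shows "regular (projective_space n) (chart n i) (\<lambda>L. normalized i L j)"
proof -
  have "projective_quotient n (chart n i) (\<lambda>L. normalized i L j)"
  proof (rule projective_quotientI[OF openin_chart[OF assms(1)]
        homogeneous_form_coordinate[of j "Suc n"] homogeneous_form_coordinate[of i "Suc n"]])
    fix L v assume L: "L \<in> chart n i" and v: "v \<in> L - {\<lambda>_. 0}"
    show nz: "v i \<noteq> 0" using L v unfolding chart_def by blast
    obtain w where w: "w \<in> coordinate_space (Suc n)" "w i \<noteq> 0" "L = line w" using L by (rule chartE)
    then obtain c where c: "v = (\<lambda>i. c * w i)" using v unfolding line_def by blast
    then show "normalized i L j = v j / v i" using nz w normalized_line[of w i, OF w(2)] by simp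
  qed (use assms in auto)
  then show ?thesis unfolding regular_projective_space_iff using openin_chart[OF assms(1)] by blast
qed

section \<open>Irreducibility, the additive group, and projective space as a variety\<close>

section \<open>The affine line and irreducibility\<close>

text \<open>Over a finite field, with \<open>P\<close> the product of all X - a, the polynomial
  \<open>1 + P\<close> would take the value 1 at every element although its degree is
  positive.\<close>

lemma infinite_UNIV_alg_closed: "infinite (UNIV :: 'k :: alg_closed_field set)"
proof
  assume fin: "finite (UNIV :: 'k set)"
  define P :: "'k poly" where "P = (\<Prod>a\<in>UNIV. [:- a, 1:])"
  have "Polynomial.degree P = card (UNIV :: 'k set)"
    unfolding P_def by (subst degree_prod_eq_sum_degree) auto
  then have "Polynomial.degree P > 0" using fin by (simp add: card_gt_0_iff)
  then have "Polynomial.degree (1 + P) > 0" by (simp add: degree_add_eq_right)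
  then obtain x where "poly (1 + P) x = 0" using alg_closed_imp_poly_has_root by blast
  moreover have "poly P x = 0" unfolding P_def poly_prod using fin by (intro prod_zero) auto
  ultimately show False by simp
qed

definition affine_point :: "'k :: zero \<Rightarrow> nat \<Rightarrow> 'k" where
  "affine_point t = (\<lambda>i. if i = 0 then t else 0)"

lemma affine_point_0 [simp]: "affine_point t 0 = t"
  by (simp add: affine_point_def)

lemma affine_point_in: "affine_point t \<in> coordinate_space 1"
  by (simp add: affine_point_def coordinate_space_def)

declare affine_point_in [simplified, simp]

lemma affine_point_eq: "x \<in> coordinate_space 1 \<Longrightarrow> affine_point (x 0) = x"
  by (auto simp: affine_point_def coordinate_space_def fun_eq_iff)

text \<open>Products of polynomials make the generators closed under intersection, so a nonempty
  open set contains the nonvanishing set of one nonzero polynomial, which in one variable has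
  finitely many roots.\<close>

lemma affine_line_open_cofinite:
  fixes U :: "(nat \<Rightarrow> 'k :: alg_closed_field) set"
  assumes U: "openin (zariski (affine_space 1)) U" and ne: "U \<noteq> {}"
  shows "finite {t. affine_point t \<notin> U}"
proof -
  let ?B = "{{x \<in> coordinate_space 1. p x \<noteq> 0} |p. polynomial_function 1 p} :: (nat \<Rightarrow> 'k) set set"
  obtain x where x: "x \<in> U" using ne by blast
  have Int: "V \<inter> W \<in> ?B" if V: "V \<in> ?B" and W: "W \<in> ?B" for V W
  proof -
    obtain p q where "V = {x \<in> coordinate_space 1. p x \<noteq> 0}" "polynomial_function 1 p"
      "W = {x \<in> coordinate_space 1. q x \<noteq> 0}" "polynomial_function 1 q" using V W by blast
    then show ?thesis
      by (intro CollectI exI[of _ "\<lambda>x. p x * q x"] conjI polynomial_function_mult) auto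
  qed
  have "openin (topology_generated_by ?B) U"
    using U unfolding affine_space_def affine_topology_def by simp
  from openin_topology_generated_by_basis[OF this x Int]
  obtain W where W: "W \<in> ?B" "x \<in> W" "W \<subseteq> U" by blast
  then obtain p where p: "W = {x \<in> coordinate_space 1. p x \<noteq> 0}" "polynomial_function 1 p" by blast
  obtain P :: "'k poly" where P: "\<And>x. p x = poly P (x 0)"
    using polynomial_function_1_poly[OF p(2)] by blast
  have "P \<noteq> 0" using W(2) P unfolding p(1) by auto
  then have "finite {t. poly P t = 0}" by (rule poly_roots_finite)
  moreover have "affine_point t \<in> U" if "poly P t \<noteq> 0" for t
    using that W(3) affine_point_in[of t] unfolding p(1) P by auto
  then have "{t. affine_point t \<notin> U} \<subseteq> {t. poly P t = 0}" by blast
  ultimately show ?thesis by (rule rev_finite_subset)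
qed

lemma affine_line_irreducible:
  fixes U V :: "(nat \<Rightarrow> 'k :: alg_closed_field) set"
  assumes "openin (zariski (affine_space 1)) U" "U \<noteq> {}"
    "openin (zariski (affine_space 1)) V" "V \<noteq> {}"
  shows "U \<inter> V \<noteq> {}"
proof
  assume "U \<inter> V = {}"
  then have "UNIV \<subseteq> {t. affine_point t \<notin> U} \<union> {t. affine_point t \<notin> V}" by auto
  moreover have "finite ({t. affine_point t \<notin> U} \<union> {t. affine_point t \<notin> V})"
    using affine_line_open_cofinite assms by blast
  ultimately have "finite (UNIV :: 'k set)" by (rule finite_subset)
  then show False using infinite_UNIV_alg_closed[where ?'k = 'k] by simp
qed

text \<open>Pulling \<open>U\<close> and \<open>V\<close> back along a curve through a point of each
  gives two nonempty open subsets of the affine line, and these meet. Irreducibility of affine and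
  of projective space is thus reduced to dimension one.\<close>

lemma irreducible_if_joined_by_lines:
  fixes S :: "('a, 'k :: alg_closed_field) function_space"
  assumes joined: "\<And>x y. \<lbrakk>x \<in> points S; y \<in> points S\<rbrakk> \<Longrightarrow>
      \<exists>h s t. morphism (affine_space 1) S h \<and> h (affine_point s) = x \<and> h (affine_point t) = y"
    and U: "openin (zariski S) U" "U \<noteq> {}" and V: "openin (zariski S) V" "V \<noteq> {}"
  shows "U \<inter> V \<noteq> {}"
proof -
  obtain x y where xy: "x \<in> U" "y \<in> V" using U V by blast
  then have "x \<in> points S" "y \<in> points S" using openin_subset U(1) V(1) by blast+
  then obtain h s t where h: "morphism (affine_space 1) S h"
    "h (affine_point s) = x" "h (affine_point t) = y" using joined by blast
  let ?pre = "\<lambda>W. {t \<in> points (affine_space 1). h t \<in> W}"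
  have "?pre U \<inter> ?pre V \<noteq> {}"
    by (rule affine_line_irreducible[OF morphism_open[OF h(1) U(1)] _ morphism_open[OF h(1) V(1)]])
      (use h(2,3) xy affine_point_in points_affine_space in blast)+
  then show ?thesis by blast
qed

lemma affine_space_irreducible:
  fixes U V :: "(nat \<Rightarrow> 'k :: alg_closed_field) set"
  assumes "openin (zariski (affine_space n)) U" "U \<noteq> {}"
    "openin (zariski (affine_space n)) V" "V \<noteq> {}"
  shows "U \<inter> V \<noteq> {}"
proof (rule irreducible_if_joined_by_lines[OF _ assms])
  fix x y :: "nat \<Rightarrow> 'k" assume xy: "x \<in> points (affine_space n)" "y \<in> points (affine_space n)"
  interpret A: space_with_functions "affine_space 1 :: (nat \<Rightarrow> 'k, 'k) function_space"
    by (rule space_with_functions_affine)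
  let ?h = "\<lambda>t i. (1 - t 0) * x i + t (0 :: nat) * y i"
  have "morphism (affine_space 1) (affine_space n) ?h"
  proof (rule morphism_affine_space[OF space_with_functions_affine])
    show "?h t \<in> coordinate_space n" for t
      using xy unfolding points_affine_space by (simp add: coordinate_space_def)
    show "regular (affine_space 1) (points (affine_space 1)) (\<lambda>t. ?h t i)" for i
      by (intro A.regular_add A.regular_mult A.regular_diff A.regular_const
          regular_affine_polynomial[OF polynomial_function_coordinate]) auto
  qed
  moreover have "?h (affine_point 0) = x" "?h (affine_point 1) = y" by simp_all
  ultimately show "\<exists>h s t. morphism (affine_space 1) (affine_space n) h \<and>
      h (affine_point s) = x \<and> h (affine_point t) = y"
    by (intro exI conjI)
qed

lemma connected_affine_space:
  "connected_space (zariski (affine_space n :: (nat \<Rightarrow> 'k :: alg_closed_field, 'k) function_space))"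
  unfolding connected_space_def using affine_space_irreducible by blast

lemma affine_variety_affine_space: "affine_variety (affine_space n)"
proof -
  interpret space_with_functions "affine_space n :: (nat \<Rightarrow> 'a, 'a) function_space"
    by (rule space_with_functions_affine)
  have "isomorphism (affine_space n) (induced_space (affine_space n) (points (affine_space n :: (nat \<Rightarrow> 'a, 'a) function_space))) (\<lambda>x. x)"
    unfolding induced_space_points by (rule isomorphismI[OF morphism_id morphism_id]) auto
  then show ?thesis unfolding affine_variety_def
    using space_with_functions_affine closedin_topspace by blast
qed

lemma linear_algebraic_group_vector_group: "linear_algebraic_group (vector_group n)"
proof -
  let ?A = "affine_space n :: (nat \<Rightarrow> 'a, 'a) function_space"
  let ?G = "vector_group n :: (nat \<Rightarrow> 'a, 'a) algebraic_group"
  note A = space_with_functions_affine[of n, where ?'a = 'a]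
  interpret A: space_with_functions ?A by (rule A)
  interpret P: space_with_functions "product_space ?A ?A"
    by (rule space_with_functions_product[OF A A])
  have car: "carrier ?G = coordinate_space n" and one: "\<one>\<^bsub>?G\<^esub> = (\<lambda>_. 0)"
    and mult: "x \<otimes>\<^bsub>?G\<^esub> y = (\<lambda>i. x i + y i)" and und: "underlying ?G = ?A" for x y
    by (simp_all add: vector_group_def)
  interpret group ?G
  proof (rule groupI)
    fix x assume "x \<in> carrier ?G"
    then show "\<exists>y\<in>carrier ?G. y \<otimes>\<^bsub>?G\<^esub> x = \<one>\<^bsub>?G\<^esub>"
      unfolding car one mult
      by (intro bexI[of _ "\<lambda>i. - x i"]) (auto simp: coordinate_space_def)
  qed (auto simp: car one mult coordinate_space_def add.assoc)
  have inv: "inv\<^bsub>?G\<^esub> x = (\<lambda>i. - x i)" if "x \<in> carrier ?G" for x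
    by (rule inv_equality) (use that in \<open>auto simp: car one mult coordinate_space_def\<close>)
  have coord: "regular ?A (points ?A) (\<lambda>x. x i)" if "i < n" for i
    by (rule regular_affine_polynomial[OF polynomial_function_coordinate[OF that] openin_topspace])
  show ?thesis
  proof
    show "points (underlying ?G) = carrier ?G" unfolding und car points_affine_space ..
    show "affine_variety (underlying ?G)" unfolding und by (rule affine_variety_affine_space)
    have pts: "points (product_space ?A ?A) = coordinate_space n \<times> coordinate_space n"
      by (simp add: points_product_space[OF A A] points_affine_space)
    have "morphism (product_space ?A ?A) ?A (\<lambda>p i. fst p i + snd p i)"
    proof (rule morphism_affine_space[OF P.space_with_functions_axioms])
      fix i assume i: "i < n"
      have "{p \<in> points (product_space ?A ?A). fst p \<in> points ?A} = points (product_space ?A ?A)"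
        "{p \<in> points (product_space ?A ?A). snd p \<in> points ?A} = points (product_space ?A ?A)"
        by (auto simp: pts points_affine_space)
      then show "regular (product_space ?A ?A) (points (product_space ?A ?A)) (\<lambda>p. fst p i + snd p i)"
        using morphism_regular[OF morphism_fst[OF A A] coord[OF i]]
          morphism_regular[OF morphism_snd[OF A A] coord[OF i]]
        by (simp add: P.regular_add)
    qed (auto simp: pts coordinate_space_def)
    then show "morphism (product_space (underlying ?G) (underlying ?G)) (underlying ?G)
        (\<lambda>(x, y). x \<otimes>\<^bsub>?G\<^esub> y)"
      unfolding und mult by (simp add: case_prod_unfold)
    have "morphism ?A ?A (\<lambda>x. inv\<^bsub>?G\<^esub> x)"
    proof (rule morphism_affine_space[OF A])
      fix i assume i: "i < n"
      show "regular ?A (points ?A) (\<lambda>x. (inv\<^bsub>?G\<^esub> x) i)"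
        by (rule A.regular_cong[OF A.regular_uminus[OF coord[OF i]]])
          (simp add: inv car points_affine_space)
    next
      fix x assume "x \<in> points ?A" then show "inv\<^bsub>?G\<^esub> x \<in> coordinate_space n"
        using inv_closed[of x] unfolding car points_affine_space by simp
    qed
    then show "morphism (underlying ?G) (underlying ?G) (\<lambda>x. inv\<^bsub>?G\<^esub> x)" unfolding und .
  qed
qed

section \<open>Projective space is a variety\<close>

lemma projective_space_irreducible:
  fixes U V :: "(nat \<Rightarrow> 'k :: alg_closed_field) set set"
  assumes "openin (zariski (projective_space n)) U" "U \<noteq> {}"
    "openin (zariski (projective_space n)) V" "V \<noteq> {}"
  shows "U \<inter> V \<noteq> {}"
proof (rule irreducible_if_joined_by_lines[OF _ assms])
  let ?P = "projective_space n :: ((nat \<Rightarrow> 'k) set, 'k) function_space"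
  interpret A: space_with_functions "affine_space 1 :: (nat \<Rightarrow> 'k, 'k) function_space"
    by (rule space_with_functions_affine)
  fix L M assume LM: "L \<in> points ?P" "M \<in> points ?P"
  show "\<exists>h s t. morphism (affine_space 1) ?P h \<and> h (affine_point s) = L \<and> h (affine_point t) = M"
  proof (cases "L = M")
    case True
    then show ?thesis using morphism_const[OF space_with_functions_affine space_with_functions_projective LM(1)] by blast
  next
    case False
    obtain v where v: "v \<in> coordinate_space (Suc n)" "v \<noteq> (\<lambda>_. 0)" "L = line v"
      using LM(1) projective_pointE unfolding points_projective_space by blast
    obtain w where w: "w \<in> coordinate_space (Suc n)" "w \<noteq> (\<lambda>_. 0)" "M = line w"
      using LM(2) projective_pointE unfolding points_projective_space by blast
    \<comment> \<open>This line in the vector space misses the origin because \<open>v\<close> and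
      \<open>w\<close> are not proportional. For equal points it could pass through 0, which is why
      that case is treated separately.\<close>
    let ?h = "\<lambda>t i. (1 - t 0) * v i + t (0 :: nat) * w i"
    have nz: "?h t \<noteq> (\<lambda>_. 0)" for t
    proof
      assume "?h t = (\<lambda>_. 0)"
      then have h: "(1 - t 0) * v i + t 0 * w i = 0" for i by (simp add: fun_eq_iff)
      show False
      proof (cases "t 0 = 1")
        case True then show False using h w(2) by (auto simp: fun_eq_iff)
      next
        case t: False
        then have "v = (\<lambda>i. (t 0 / (t 0 - 1)) * w i)"
          using h by (auto simp: fun_eq_iff field_simps)
        moreover from this v(2) have "t 0 / (t 0 - 1) \<noteq> 0" by auto
        ultimately have "line v = line w" using line_scale by metis
        with False v(3) w(3) show False by simp
      qed
    qed
    have "morphism (affine_space 1) ?P (\<lambda>t. line (?h t))"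
    proof (rule morphism_projective_space[OF space_with_functions_affine], intro exI conjI allI impI ballI)
      show "openin (zariski (affine_space 1)) (points (affine_space 1))" by (rule openin_topspace)
      show "regular (affine_space 1) (points (affine_space 1)) (\<lambda>t. ?h t i)" for i
        by (intro A.regular_add A.regular_mult A.regular_diff A.regular_const
            regular_affine_polynomial[OF polynomial_function_coordinate]) auto
      show "?h t \<in> coordinate_space (Suc n)" for t using v(1) w(1) by (simp add: coordinate_space_def)
    qed (use nz in auto)
    moreover have "line (?h (affine_point 0)) = L" "line (?h (affine_point 1)) = M"
      by (simp_all add: v(3) w(3))
    ultimately show ?thesis by (intro exI[of _ "\<lambda>t. line (?h t)"] exI conjI)
  qed
qed

text \<open>The chart is identified with the closed hyperplane where coordinate \<open>i\<close> is
  1 in affine space of dimension \<open>n + 1\<close>; the mutually inverse maps are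
  \<open>normalized i\<close> and \<open>line\<close>.\<close>

lemma affine_variety_chart:
  assumes i: "i \<le> n"
  shows "affine_variety (induced_space (projective_space n) (chart n i))"
proof -
  let ?P = "projective_space n :: ((nat \<Rightarrow> 'a) set, 'a) function_space"
  let ?A = "affine_space (Suc n) :: (nat \<Rightarrow> 'a, 'a) function_space"
  let ?Z = "{x \<in> coordinate_space (Suc n). x i = 1} :: (nat \<Rightarrow> 'a) set"
  interpret A: space_with_functions ?A by (rule space_with_functions_affine)
  interpret P: space_with_functions ?P by (rule space_with_functions_projective)
  have sub: "chart n i \<subseteq> projective_points n" unfolding chart_def by blast
  have pP: "points (induced_space ?P (chart n i)) = chart n i"
    using sub by (auto simp: points_induced_space points_projective_space)
  have pA: "points (induced_space ?A ?Z) = ?Z" by (auto simp: points_induced_space points_affine_space)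
  have "openin (zariski ?A) {x \<in> coordinate_space (Suc n). x i + - 1 \<noteq> 0}"
    using i by (intro openin_affine_nonvanishing polynomial_function_add
        polynomial_function_coordinate polynomial_function_const) simp
  moreover have "points ?A - ?Z = {x \<in> coordinate_space (Suc n). x i + - 1 \<noteq> 0}"
    by (auto simp: points_affine_space)
  ultimately have "closedin (zariski ?A) ?Z" unfolding closedin_def by (auto simp: points_affine_space)
  moreover have "isomorphism (induced_space ?P (chart n i)) (induced_space ?A ?Z) (normalized i)"
  proof (rule isomorphismI)
    interpret U: space_with_functions "induced_space ?P (chart n i)"
      by (rule P.space_with_functions_induced)
    interpret Z: space_with_functions "induced_space ?A ?Z"
      by (rule A.space_with_functions_induced)
    show "morphism (induced_space ?P (chart n i)) (induced_space ?A ?Z) (normalized i)"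
    proof (rule U.morphism_into_induced[OF morphism_affine_space[OF U.space_with_functions_axioms]
          A.space_with_functions_axioms], unfold pP)
      fix j assume "j < Suc n"
      then show "regular (induced_space ?P (chart n i)) (chart n i) (\<lambda>L. normalized i L j)"
        using P.regular_induced_restrict[OF regular_normalized[OF i, of j], of "chart n i" "chart n i"] by simp
    qed (use normalized_chart[of _ n i] in auto)
    show "morphism (induced_space ?A ?Z) (induced_space ?P (chart n i)) line"
    proof (rule Z.morphism_into_induced[OF morphism_projective_space[OF Z.space_with_functions_axioms]
          P.space_with_functions_axioms], unfold pA, intro exI conjI allI impI ballI)
      show "openin (zariski (induced_space ?A ?Z)) ?Z" using openin_topspace[of "zariski (induced_space ?A ?Z)"] pA by simp
      fix j assume "j \<le> n"
      then show "regular (induced_space ?A ?Z) ?Z (\<lambda>x. x j)"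
        by (intro A.regular_induced_restrict[OF regular_affine_polynomial[OF polynomial_function_coordinate openin_topspace]])
          (auto simp: points_affine_space)
    next
      fix x assume x: "x \<in> ?Z"
      then show nz: "x \<noteq> (\<lambda>_. 0)" by auto
      show "line x \<in> chart n i" using x line_mem_chart_iff[OF _ nz i] by simp
    qed auto
  next
    fix L assume "L \<in> points (induced_space ?P (chart n i))"
    then show "line (normalized i L) = L" unfolding pP by (rule normalized_chart)
  next
    fix x assume "x \<in> points (induced_space ?A ?Z)"
    then have "x i = 1" unfolding pA by simp
    then show "normalized i (line x) = x" using normalized_line[of x i] by simp
  qed
  ultimately show ?thesis
    unfolding affine_variety_def using P.space_with_functions_induced by blast
qed

lemma projective_space_separated:
  fixes n :: nat
  defines "P \<equiv> projective_space n :: ((nat \<Rightarrow> 'k :: alg_closed_field) set, 'k) function_space"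
  shows "closedin (zariski (product_space P P)) {(L, L) | L. L \<in> points P}"
proof -
  have P: "space_with_functions P" unfolding P_def by (rule space_with_functions_projective)
  interpret space_with_functions P by (rule P)
  have pts: "points (product_space P P) = projective_points n \<times> projective_points n"
    using points_product_space[OF P P] unfolding P_def points_projective_space .
  have "openin (zariski (product_space P P)) (points (product_space P P) - {(L, L) | L. L \<in> points P})"
  proof (subst openin_subopen, rule ballI)
    fix p assume p: "p \<in> points (product_space P P) - {(L, L) | L. L \<in> points P}"
    obtain L M where LM: "p = (L, M)" "L \<in> projective_points n" "M \<in> projective_points n" "L \<noteq> M"
      using p unfolding pts by (auto simp: P_def points_projective_space)
    obtain i where i: "i \<le> n" "L \<in> chart n i" using LM(2) by (rule chart_cover)
    obtain j where j: "j \<le> n" "M \<in> chart n j" using LM(3) by (rule chart_cover)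
    \<comment> \<open>Since coordinate \<open>i\<close> of the first vector is 1 on its chart, this
      is the 2 x 2 minor of the two normalized vectors in columns \<open>k\<close> and
      \<open>i\<close>. If all these minors vanish the vectors are proportional, and each minor is a
      tensor function.\<close>
    let ?d = "\<lambda>k (p :: (nat \<Rightarrow> 'k) set \<times> (nat \<Rightarrow> 'k) set). normalized i (fst p) k * normalized j (snd p) i - normalized j (snd p) k"
    have "\<exists>k\<le>n. ?d k (L, M) \<noteq> 0"
    proof (rule ccontr)
      assume "\<not> ?thesis"
      then have "normalized j M k = normalized j M i * normalized i L k" if "k \<le> n" for k
        using that by (auto simp: mult.commute)
      moreover have "normalized j M k = normalized j M i * normalized i L k" if "\<not> k \<le> n" for k
        using that normalized_chart(1)[OF i(2)] normalized_chart(1)[OF j(2)]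
        by (simp add: coordinate_space_def)
      ultimately have eq: "normalized j M = (\<lambda>k. normalized j M i * normalized i L k)" by blast
      then have "normalized j M i \<noteq> 0" using normalized_nonzero[OF j(2)] by (metis mult_zero_left)
      then have "line (normalized j M) = line (normalized i L)" using eq line_scale by metis
      then show False using normalized_chart(3)[OF i(2)] normalized_chart(3)[OF j(2)] LM(4) by simp
    qed
    then obtain k where k: "k \<le> n" "?d k (L, M) \<noteq> 0" by blast
    let ?D = "{p \<in> chart n i \<times> chart n j. ?d k p \<noteq> 0}"
    have oi: "openin (zariski P) (chart n i)" and oj: "openin (zariski P) (chart n j)"
      unfolding P_def by (rule openin_chart i j)+
    note reg = regular_normalized[where ?'a = 'k and n = n, folded P_def]
    have "tensor_function P P (chart n i) (chart n j)
        (\<lambda>p. (case p of (x, y) \<Rightarrow> normalized i x k * normalized j y i) +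
             (case p of (x, y) \<Rightarrow> (- 1) * normalized j y k))"
      by (intro tensor_function_add tensor_function_regular reg i j k regular_const oi)
    then have "tensor_function P P (chart n i) (chart n j) (?d k)" by (simp add: case_prod_unfold)
    then have "openin (zariski (product_space P P)) ?D" by (rule openin_product_spaceI[OF P P oi oj])
    moreover have "p \<in> ?D" using LM(1) i j k by simp
    moreover have "?D \<subseteq> points (product_space P P) - {(L, L) | L. L \<in> points P}"
    proof
      fix q assume q: "q \<in> ?D"
      \<comment> \<open>On the diagonal the two normalized vectors are multiples of one vector
        \<open>v\<close>, so the minor cancels.\<close>
      have "fst q \<noteq> snd q"
      proof
        assume eq: "fst q = snd q"
        with q obtain v where v: "v \<in> coordinate_space (Suc n)" "v i \<noteq> 0" "snd q = line v"
          by (auto elim: chartE)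
        have "v \<noteq> (\<lambda>_. 0)" using v(2) by auto
        then have "v j \<noteq> 0" using q v line_mem_chart_iff[OF v(1) _ j(1)] by auto
        then have "?d k q = 0" unfolding eq v(3) using v(2) by (simp add: normalized_line)
        with q show False by blast
      qed
      moreover have "q \<in> points (product_space P P)" using q unfolding pts chart_def by auto
      ultimately show "q \<in> points (product_space P P) - {(L, L) | L. L \<in> points P}" by auto
    qed
    ultimately show "\<exists>T. openin (zariski (product_space P P)) T \<and> p \<in> T \<and>
        T \<subseteq> points (product_space P P) - {(L, L) | L. L \<in> points P}" by blast
  qed
  moreover have "{(L, L) | L. L \<in> points P} \<subseteq> points (product_space P P)"
    unfolding pts by (auto simp: P_def points_projective_space)
  ultimately show ?thesis unfolding closedin_def by blast
qed

lemma variety_projective_space: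
  "variety (projective_space n :: ((nat \<Rightarrow> 'k :: alg_closed_field) set, 'k) function_space)"
proof -
  let ?P = "projective_space n :: ((nat \<Rightarrow> 'k) set, 'k) function_space"
  have "\<Union>(chart n ` {..n}) = (projective_points n :: (nat \<Rightarrow> 'k) set set)"
  proof
    show "\<Union>(chart n ` {..n}) \<subseteq> (projective_points n :: (nat \<Rightarrow> 'k) set set)"
      unfolding chart_def by blast
    show "(projective_points n :: (nat \<Rightarrow> 'k) set set) \<subseteq> \<Union>(chart n ` {..n})"
      using chart_cover by blast
  qed
  \<comment> \<open>The point [1 : 0 : ... : 0] witnesses that the space is nonempty.\<close>
  moreover have "line (affine_point 1) \<in> points ?P"
    unfolding points_projective_space projective_points_iff
    by (intro exI[of _ "affine_point 1"]) (auto simp: affine_point_def coordinate_space_def fun_eq_iff)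
  ultimately show ?thesis
    unfolding variety_def
    using space_with_functions_projective projective_space_separated[of n, where ?'k = 'k]
      projective_space_irreducible[of n, where ?'k = 'k]
      affine_variety_chart[of _ n, where ?'a = 'k] openin_chart[of _ n, where ?'a = 'k]
    by (intro conjI exI[of _ "chart n ` {..n}"]) (auto simp: points_projective_space)
qed

section \<open>Rational functions of one variable and maps to the projective line\<close>

section \<open>Injective pairs of polynomials without common roots\<close>

text \<open>A common root \<open>a\<close> gives a common factor X - a, and splitting it off lowers
  the sum of the degrees. The conclusion speaks of roots in the field because it is to provide
  homogeneous coordinates at every point of the line.\<close>

lemma common_roots_removed:
  fixes p q :: "'k :: field poly"
  assumes "p \<noteq> 0 \<or> q \<noteq> 0"
  shows "\<exists>g p' q'. g \<noteq> 0 \<and> p = g * p' \<and> q = g * q' \<and> (\<forall>x. poly p' x \<noteq> 0 \<or> poly q' x \<noteq> 0)"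
  using assms
proof (induction "Polynomial.degree p + Polynomial.degree q" arbitrary: p q rule: less_induct)
  case less
  show ?case
  proof (cases "\<forall>x. poly p x \<noteq> 0 \<or> poly q x \<noteq> 0")
    case True
    then show ?thesis by (intro exI[of _ 1] exI[of _ p] exI[of _ q]) simp
  next
    case False
    then obtain a where a: "poly p a = 0" "poly q a = 0" by blast
    then obtain p1 q1 where pq: "p = [:- a, 1:] * p1" "q = [:- a, 1:] * q1"
      unfolding poly_eq_0_iff_dvd by (auto elim!: dvdE)
    have deg: "Polynomial.degree ([:- a, 1:] * r) = (if r = 0 then 0 else Suc (Polynomial.degree r))" for r
      by (auto simp: degree_mult_eq simp del: mult_pCons_left)
    \<comment> \<open>With one quotient nonzero, the sum of the degrees drops strictly even when the
      other polynomial is 0.\<close>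
    have nz: "p1 \<noteq> 0 \<or> q1 \<noteq> 0" using less.prems pq by auto
    then have "Polynomial.degree p1 + Polynomial.degree q1 < Polynomial.degree p + Polynomial.degree q"
      unfolding pq deg by auto
    from less.hyps[OF this nz] obtain g p' q' where g: "g \<noteq> 0" "p1 = g * p'" "q1 = g * q'"
      "\<forall>x. poly p' x \<noteq> 0 \<or> poly q' x \<noteq> 0" by blast
    have "p = ([:- a, 1:] * g) * p'" "q = ([:- a, 1:] * g) * q'" unfolding pq g mult.assoc by (rule refl)+
    moreover have "[:- a, 1:] * g \<noteq> 0" using g(1) by (simp del: mult_pCons_left)
    ultimately show ?thesis using g(4) by blast
  qed
qed

text \<open>A nonconstant \<open>p\<close> has a root. There \<open>q\<close> does not vanish, and
  in characteristic 0 differentiation lowers the order of \<open>p\<close> by exactly one, so the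
  left side of \<open>W\<close> would have smaller order than the right side.\<close>

lemma degree_0_if_wronskian_0:
  fixes p q :: "'k :: {alg_closed_field, field_char_0} poly"
  assumes W: "pderiv p * q = p * pderiv q" and no_common: "\<And>x. poly p x \<noteq> 0 \<or> poly q x \<noteq> 0"
  shows "Polynomial.degree p = 0"
proof (rule ccontr)
  assume deg: "Polynomial.degree p \<noteq> 0"
  then obtain a where a: "poly p a = 0" using alg_closed_imp_poly_has_root by blast
  then have qa: "poly q a \<noteq> 0" using no_common[of a] by simp
  have p': "pderiv p \<noteq> 0" using deg by (simp add: pderiv_eq_0_iff)
  have nz: "pderiv p * q \<noteq> 0" using p' qa by auto
  have "p \<noteq> 0" using deg by auto
  then have "order a p = Suc (order a (pderiv p))" using a by (rule order_pderiv)
  moreover have "order a (pderiv p * q) = order a (pderiv p)"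
    using nz qa by (simp add: order_mult order_0I)
  moreover have "order a (p * pderiv q) = order a p + order a (pderiv q)"
    using nz unfolding W by (simp add: order_mult)
  ultimately show False unfolding W by simp
qed

text \<open>If the degree of the rational function \<open>p / q\<close> is at least two, then almost every fibre
  \<open>p = c q\<close> consists by injectivity of a single multiple root, which is a zero of the Wronskian.\<close>

lemma injective_quotient_degree_le_1:
  fixes p q :: "'k :: {alg_closed_field, field_char_0} poly"
  assumes no_common: "\<And>x. poly p x \<noteq> 0 \<or> poly q x \<noteq> 0"
    and inj: "\<And>s t. poly p s * poly q t = poly p t * poly q s \<Longrightarrow> s = t"
  shows "Polynomial.degree p \<le> 1" "Polynomial.degree q \<le> 1"
proof -
  define d where "d = max (Polynomial.degree p) (Polynomial.degree q)"
  have "d \<le> 1"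
  proof (rule ccontr)
    assume "\<not> d \<le> 1"
    then have d: "d \<ge> 2" by simp
    define W where "W = pderiv p * q - p * pderiv q"
    \<comment> \<open>The excluded value is the one for which the coefficients of degree
      \<open>d\<close> cancel in \<open>p - c q\<close>. If that coefficient of \<open>q\<close> is
      0, division by 0 yields 0; excluding \<open>c = 0\<close> is then harmless, since no
      cancellation occurs.\<close>
    define C where "C = UNIV - {Polynomial.coeff p d / Polynomial.coeff q d}"
    have top: "Polynomial.coeff p d \<noteq> 0 \<or> Polynomial.coeff q d \<noteq> 0"
      using d unfolding d_def by (cases "Polynomial.degree p \<le> Polynomial.degree q")
        (auto simp: max_def leading_coeff_0_iff)
    have fibre: "\<exists>t. poly p t = c * poly q t \<and> poly W t = 0" if c: "c \<in> C" for c
    proof -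
      define r where "r = p - Polynomial.smult c q"
      have "Polynomial.coeff r d \<noteq> 0"
        using c top unfolding C_def r_def by (auto simp: field_simps)
      then have "Polynomial.degree r \<ge> d" by (rule le_degree)
      then have deg: "Polynomial.degree r \<ge> 2" using d by simp
      then obtain t where t: "poly r t = 0" using alg_closed_imp_poly_has_root[of r] by auto
      then obtain s where s: "r = [:- t, 1:] * s" unfolding poly_eq_0_iff_dvd by (auto elim: dvdE)
      have "s \<noteq> 0" using deg s by auto
      then have "Polynomial.degree r = Suc (Polynomial.degree s)" 
        unfolding s by (simp add: degree_mult_eq del: mult_pCons_left)
      \<comment> \<open>A second root of \<open>r\<close>, counted with multiplicity. Injectivity
        forces it to equal \<open>t\<close>, so both \<open>r\<close> and its derivative vanish at
        \<open>t\<close>.\<close>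
      then obtain t' where t': "poly s t' = 0" using deg alg_closed_imp_poly_has_root[of s] by auto
      then have "poly r t' = 0" unfolding s by simp
      with t have "poly p t = c * poly q t" "poly p t' = c * poly q t'" unfolding r_def by simp_all
      then have "t' = t" using inj[of t' t] by simp
      then have "poly (pderiv r) t = 0" using t' 
        unfolding s by (simp add: pderiv_mult pderiv_pCons del: mult_pCons_left)
      then have "poly (pderiv p) t = c * poly (pderiv q) t"
        unfolding r_def by (simp add: pderiv_diff pderiv_smult)
      then show ?thesis using t unfolding W_def r_def by auto
    qed
    then obtain f where f: "\<And>c. c \<in> C \<Longrightarrow> poly p (f c) = c * poly q (f c) \<and> poly W (f c) = 0" by metis
    \<comment> \<open>A point shared by two different fibres would be a common root of
      \<open>p\<close> and \<open>q\<close>. So infinitely many fibres supply infinitely many roots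
      of the Wronskian.\<close>
    have "inj_on f C"
    proof (rule inj_onI)
      fix c c' assume "c \<in> C" "c' \<in> C" "f c = f c'"
      then have "c * poly q (f c) = c' * poly q (f c)" using f by metis
      moreover have "poly q (f c) \<noteq> 0" using f[OF \<open>c \<in> C\<close>] no_common[of "f c"] by auto
      ultimately show "c = c'" by simp
    qed
    moreover have "infinite C" unfolding C_def using infinite_UNIV_char_0 by auto
    ultimately have "infinite (f ` C)" using finite_imageD by blast
    moreover have "f ` C \<subseteq> {x. poly W x = 0}" using f by auto
    ultimately have "infinite {x. poly W x = 0}" using finite_subset by blast
    then have W0: "W = 0" using poly_roots_finite by blast
    have "Polynomial.degree p = 0"
      by (rule degree_0_if_wronskian_0[OF _ no_common]) (use W0 in \<open>simp add: W_def\<close>)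
    moreover have "Polynomial.degree q = 0"
      by (rule degree_0_if_wronskian_0[of _ p]) (use W0 no_common in \<open>auto simp: W_def mult.commute\<close>)
    ultimately show False using d unfolding d_def by simp
  qed
  then show "Polynomial.degree p \<le> 1" "Polynomial.degree q \<le> 1" unfolding d_def by simp_all
qed

section \<open>The projective line\<close>

definition vec2 :: "'k \<Rightarrow> 'k \<Rightarrow> nat \<Rightarrow> 'k :: zero" where
  "vec2 x y = (\<lambda>i. if i = 0 then x else if i = 1 then y else 0)"

lemma vec2_nth [simp]: "vec2 x y 0 = x" "vec2 x y (Suc 0) = y"
  by (simp_all add: vec2_def)

lemma vec2_in: "vec2 x y \<in> coordinate_space (Suc 1)"
  by (simp add: vec2_def coordinate_space_def)

lemma vec2_eq: "v \<in> coordinate_space (Suc 1) \<Longrightarrow> vec2 (v 0) (v 1) = v"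
  by (auto simp: vec2_def coordinate_space_def fun_eq_iff)

lemma vec2_eq_0_iff: "vec2 x y = (\<lambda>_. 0) \<longleftrightarrow> x = 0 \<and> y = 0"
  by (auto simp: vec2_def fun_eq_iff)

lemma vec2_scale: "(\<lambda>i. c * vec2 x y i) = vec2 (c * x) (c * y :: 'k :: field)"
  by (auto simp: vec2_def)

lemma line_vec2_scale: "c \<noteq> 0 \<Longrightarrow> line (vec2 (c * x) (c * y)) = line (vec2 x y)"
  unfolding vec2_scale[symmetric] by (rule line_scale)

lemma line_vec2_eqD:
  assumes "line (vec2 x y) = line (vec2 x' y')" shows "x * y' = x' * y"
proof -
  obtain c where c: "vec2 x y = (\<lambda>i. c * vec2 x' y' i)" using line_eqD[OF assms] by blast
  have "x = c * x'" "y = c * y'" using fun_cong[OF c, of 0] fun_cong[OF c, of 1] by simp_all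
  then show ?thesis by simp
qed

lemma line_vec2_eqI:
  assumes eq: "x * y' = x' * y" and nz: "x \<noteq> 0 \<or> y \<noteq> 0" "x' \<noteq> 0 \<or> y' \<noteq> 0"
  shows "line (vec2 x y) = line (vec2 x' y')"
proof (cases "x' = 0")
  case True
  then have "y' \<noteq> 0" "x = 0" "y \<noteq> 0" using eq nz by auto
  then show ?thesis using True line_vec2_scale[of "y / y'" 0 y'] by simp
next
  case False
  then have "x \<noteq> 0" using eq nz by auto
  moreover have "x / x' * y' = y" using eq False by (simp add: field_simps)
  ultimately show ?thesis using False line_vec2_scale[of "x / x'" x' y'] by simp
qed

lemma projective_line_iff:
  "L \<in> projective_points 1 \<longleftrightarrow> (\<exists>x y. (x \<noteq> 0 \<or> y \<noteq> 0) \<and> L = line (vec2 x y))"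
proof
  assume "L \<in> projective_points 1"
  then obtain v where v: "v \<in> coordinate_space (Suc 1)" "v \<noteq> (\<lambda>_. 0)" "L = line v"
    by (rule projective_pointE)
  then show "\<exists>x y. (x \<noteq> 0 \<or> y \<noteq> 0) \<and> L = line (vec2 x y)"
    using vec2_eq[OF v(1)] vec2_eq_0_iff by metis
next
  assume "\<exists>x y. (x \<noteq> 0 \<or> y \<noteq> 0) \<and> L = line (vec2 x y)"
  then show "L \<in> projective_points 1"
    unfolding projective_points_iff using vec2_in vec2_eq_0_iff by metis
qed

lemma projective_lineE:
  assumes "L \<in> projective_points 1"
  obtains x y where "x \<noteq> 0 \<or> y \<noteq> 0" "L = line (vec2 x y)"
  using assms unfolding projective_line_iff by blast

lemma normalized_vec2:
  assumes "L \<in> chart 1 i"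
  shows "vec2 (normalized i L 0) (normalized i L 1) = normalized i L"
  by (rule vec2_eq[OF normalized_chart(1)[OF assms]])

text \<open>Near \<open>s\<close> a chart coordinate of \<open>h\<close> is a quotient of
  polynomials, on an open set that is automatically cofinite. The resulting pair is therefore exact
  and nonzero at the prescribed \<open>s\<close> and represents \<open>h\<close> at almost all other
  points.\<close>

lemma morphism_affine_line_projective_line_local:
  fixes h :: "(nat \<Rightarrow> 'k :: alg_closed_field) \<Rightarrow> (nat \<Rightarrow> 'k) set"
  assumes h: "morphism (affine_space 1) (projective_space 1) h"
  shows "\<exists>p q. (poly p s \<noteq> 0 \<or> poly q s \<noteq> 0) \<and> h (affine_point s) = line (vec2 (poly p s) (poly q s)) \<and>
    finite {t. h (affine_point t) \<noteq> line (vec2 (poly p t) (poly q t))}"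
proof -
  have "h (affine_point s) \<in> projective_points 1"
    using morphism_points[OF h, of "affine_point s"]
    by (simp only: points_affine_space points_projective_space affine_point_in)
  then obtain i where i: "i \<le> 1" "h (affine_point s) \<in> chart 1 i" by (rule chart_cover)
  define j where "j = 1 - i"
  have j: "j \<le> 1" unfolding j_def by simp
  let ?U = "{x \<in> points (affine_space 1). h x \<in> chart 1 i}"
  have "regular (affine_space 1) ?U (\<lambda>x. normalized i (h x) j)"
    by (rule morphism_regular[OF h regular_normalized[OF i(1) j]])
  moreover have "affine_point s \<in> ?U" using i(2) by (simp only: points_affine_space affine_point_in mem_Collect_eq)
  ultimately obtain V where V: "affine_point s \<in> V" "V \<subseteq> ?U"
    "affine_quotient 1 V (\<lambda>x. normalized i (h x) j)"
    unfolding regular_affine_space_iff by blast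
  then obtain a b where ab: "openin (zariski (affine_space 1)) V"
    "polynomial_function 1 a" "polynomial_function 1 b"
    "\<And>y. y \<in> V \<Longrightarrow> b y \<noteq> 0 \<and> normalized i (h y) j = a y / b y"
    unfolding affine_quotient_def by blast
  obtain P Q :: "'k poly" where P: "\<And>x. a x = poly P (x 0)" and Q: "\<And>x. b x = poly Q (x 0)"
    using polynomial_function_1_poly[OF ab(2)] polynomial_function_1_poly[OF ab(3)] by metis
  have fin: "finite {t. affine_point t \<notin> V}" using affine_line_open_cofinite[OF ab(1)] V(1) by blast
  \<comment> \<open>In chart 0 the point is [1 : P/Q] = [Q : P]; in chart 1 it is [P/Q : 1] =
    [P : Q].\<close>
  define p q where "p = (if i = 0 then Q else P)" and "q = (if i = 0 then P else Q)"
  have eq: "(poly p t \<noteq> 0 \<or> poly q t \<noteq> 0) \<and> h (affine_point t) = line (vec2 (poly p t) (poly q t))"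
    if t: "affine_point t \<in> V" for t
  proof -
    have Qt: "poly Q t \<noteq> 0" and n: "normalized i (h (affine_point t)) j = poly P t / poly Q t"
      using ab(4)[OF t] unfolding P Q by simp_all
    have c: "h (affine_point t) \<in> chart 1 i" using V(2) t by blast
    note nv = normalized_vec2[OF c] normalized_chart[OF c]
    consider "i = 0" "j = 1" | "i = 1" "j = 0" using i(1) unfolding j_def by linarith
    then have "h (affine_point t) = line (vec2 (poly p t) (poly q t))"
    proof cases
      case 1
      then have "h (affine_point t) = line (vec2 1 (poly P t / poly Q t))" using nv n by metis
      then show ?thesis using 1 Qt line_vec2_scale[of "poly Q t" 1 "poly P t / poly Q t"]
        by (simp add: p_def q_def)
    next
      case 2
      then have "h (affine_point t) = line (vec2 (poly P t / poly Q t) 1)" using nv n by metis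
      then show ?thesis using 2 Qt line_vec2_scale[of "poly Q t" "poly P t / poly Q t" 1]
        by (simp add: p_def q_def)
    qed
    with Qt show ?thesis by (simp add: p_def q_def)
  qed
  have "finite {t. h (affine_point t) \<noteq> line (vec2 (poly p t) (poly q t))}"
    by (rule finite_subset[OF _ fin]) (use eq in auto)
  with eq[OF V(1)] show ?thesis by blast
qed

text \<open>The pair found at 0, freed of common roots, works everywhere. Its cross product with the
  pair exact at \<open>s\<close> vanishes at almost all points, hence identically, and at
  \<open>s\<close> both pairs are nonzero, so they span the same line.\<close>

lemma morphism_affine_line_projective_line:
  fixes h :: "(nat \<Rightarrow> 'k :: alg_closed_field) \<Rightarrow> (nat \<Rightarrow> 'k) set"
  assumes h: "morphism (affine_space 1) (projective_space 1) h"
  obtains p q where "\<And>t. poly p t \<noteq> 0 \<or> poly q t \<noteq> 0"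
    "\<And>t. h (affine_point t) = line (vec2 (poly p t) (poly q t))"
proof -
  note local = morphism_affine_line_projective_line_local[OF h]
  obtain p0 q0 where p0: "poly p0 0 \<noteq> 0 \<or> poly q0 0 \<noteq> 0"
    "finite {t. h (affine_point t) \<noteq> line (vec2 (poly p0 t) (poly q0 t))}" using local[of 0] by blast
  then have "p0 \<noteq> 0 \<or> q0 \<noteq> 0" by auto
  then obtain g p q where g: "g \<noteq> 0" "p0 = g * p" "q0 = g * q" "\<And>x. poly p x \<noteq> 0 \<or> poly q x \<noteq> 0"
    using common_roots_removed by metis
  have "h (affine_point s) = line (vec2 (poly p s) (poly q s))" for s
  proof -
    obtain p1 q1 where p1: "poly p1 s \<noteq> 0 \<or> poly q1 s \<noteq> 0"
      "h (affine_point s) = line (vec2 (poly p1 s) (poly q1 s))"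
      "finite {t. h (affine_point t) \<noteq> line (vec2 (poly p1 t) (poly q1 t))}" using local[of s] by blast
    \<comment> \<open>Agreement at \<open>t\<close> is known for the pair \<open>p0\<close>,
      \<open>q0\<close>, which brings in the factor \<open>g\<close>. It is cancelled once the
      polynomial is known to be 0.\<close>
    have "poly (g * (p * q1 - p1 * q)) t = 0"
      if "h (affine_point t) = line (vec2 (poly p0 t) (poly q0 t))"
        "h (affine_point t) = line (vec2 (poly p1 t) (poly q1 t))" for t
      using line_vec2_eqD[of "poly p0 t" "poly q0 t" "poly p1 t" "poly q1 t"] that g(2,3)
      by (simp add: algebra_simps)
    then have "UNIV \<subseteq> {t. poly (g * (p * q1 - p1 * q)) t = 0} \<union>
        ({t. h (affine_point t) \<noteq> line (vec2 (poly p0 t) (poly q0 t))} \<union>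
         {t. h (affine_point t) \<noteq> line (vec2 (poly p1 t) (poly q1 t))})" by blast
    moreover have "finite ({t. h (affine_point t) \<noteq> line (vec2 (poly p0 t) (poly q0 t))} \<union>
         {t. h (affine_point t) \<noteq> line (vec2 (poly p1 t) (poly q1 t))})" using p0(2) p1(3) by blast
    ultimately have "infinite {t. poly (g * (p * q1 - p1 * q)) t = 0}"
      using infinite_UNIV_alg_closed[where ?'k = 'k] by (meson finite_UnI finite_subset)
    then have "p * q1 - p1 * q = 0" using poly_roots_finite g(1) by (metis mult_eq_0_iff)
    then have "poly (p * q1 - p1 * q) s = 0" by simp
    then have "poly p1 s * poly q s = poly p s * poly q1 s" by (simp add: mult.commute)
    then show ?thesis unfolding p1(2) by (rule line_vec2_eqI[OF _ p1(1) g(4)])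
  qed
  with g(4) show thesis by (rule that)
qed

subsection \<open>Fractional linear transformations\<close>

text \<open>Points are sets of vectors, so the transformation is simply the image under the matrix
  with rows \<open>(a, b)\<close> and \<open>(c, d)\<close>; no representative has to be
  chosen.\<close>

definition mobius :: "'k \<Rightarrow> 'k \<Rightarrow> 'k \<Rightarrow> 'k \<Rightarrow> (nat \<Rightarrow> 'k :: field) set \<Rightarrow> (nat \<Rightarrow> 'k) set" where
  "mobius a b c d L = (\<lambda>v. vec2 (a * v 0 + b * v 1) (c * v 0 + d * v 1)) ` L"

lemma mobius_line: "mobius a b c d (line v) = line (vec2 (a * v 0 + b * v 1) (c * v 0 + d * v 1))"
proof -
  have "vec2 (a * (e * v 0) + b * (e * v 1)) (c * (e * v 0) + d * (e * v 1)) =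
      (\<lambda>i. e * vec2 (a * v 0 + b * v 1) (c * v 0 + d * v 1) i)" for e
    unfolding vec2_scale by (simp add: algebra_simps)
  moreover have "line w = range (\<lambda>e i. e * w i)" for w :: "nat \<Rightarrow> 'a" unfolding line_def by auto
  ultimately show ?thesis unfolding mobius_def by (simp add: image_image)
qed

lemma mobius_line_vec2: "mobius a b c d (line (vec2 x y)) = line (vec2 (a * x + b * y) (c * x + d * y))"
  by (simp add: mobius_line)

lemma mobius_nonzero:
  fixes a b c d x y :: "'k :: field"
  assumes "a * d - b * c \<noteq> 0" "x \<noteq> 0 \<or> y \<noteq> 0"
  shows "a * x + b * y \<noteq> 0 \<or> c * x + d * y \<noteq> 0"
proof (rule ccontr)
  assume "\<not> ?thesis"
  then have *: "a * x + b * y = 0" "c * x + d * y = 0" by auto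
  have "(a * d - b * c) * x = d * (a * x + b * y) - b * (c * x + d * y)"
    "(a * d - b * c) * y = a * (c * x + d * y) - c * (a * x + b * y)" by (simp_all add: algebra_simps)
  then show False using * assms by simp
qed

lemma mobius_point:
  "\<lbrakk>a * d - b * c \<noteq> 0; L \<in> projective_points 1\<rbrakk> \<Longrightarrow> mobius a b c d L \<in> projective_points 1"
  unfolding projective_line_iff using mobius_nonzero mobius_line_vec2 by metis

lemma mobius_mobius:
  "L \<in> projective_points 1 \<Longrightarrow> mobius a b c d (mobius a' b' c' d' L) =
     mobius (a * a' + b * c') (a * b' + b * d') (c * a' + d * c') (c * b' + d * d') L"
  by (erule projective_lineE) (simp add: mobius_line_vec2 algebra_simps)

lemma mobius_scalar:
  "\<lbrakk>c \<noteq> 0; L \<in> projective_points 1\<rbrakk> \<Longrightarrow> mobius c 0 0 c L = L"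
  by (erule projective_lineE) (simp add: mobius_line_vec2 line_vec2_scale)

text \<open>The adjugate matrix: its product with the original matrix is the determinant times the
  identity, and nonzero scalar matrices act trivially on lines.\<close>

lemma mobius_inverse:
  assumes "a * d - b * c \<noteq> 0" "L \<in> projective_points 1"
  shows "mobius d (- b) (- c) a (mobius a b c d L) = L"
  using mobius_scalar[OF assms] assms(2) by (simp add: mobius_mobius algebra_simps)

text \<open>Applying the matrix to the normalized vector of a chart gives local homogeneous
  coordinates of the image; invertibility keeps them from vanishing together.\<close>

lemma morphism_mobius:
  assumes det: "a * d - b * c \<noteq> 0"
  shows "morphism (projective_space 1) (projective_space 1) (mobius a b c d)"
proof (rule morphism_projective_space[OF space_with_functions_projective])
  interpret P: space_with_functions "projective_space 1 :: ((nat \<Rightarrow> 'a) set, 'a) function_space"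
    by (rule space_with_functions_projective)
  fix L :: "(nat \<Rightarrow> 'a) set" assume "L \<in> points (projective_space 1)"
  then obtain i where i: "i \<le> 1" "L \<in> chart 1 i" unfolding points_projective_space by (rule chart_cover)
  let ?a = "\<lambda>L. vec2 (a * normalized i L 0 + b * normalized i L 1) (c * normalized i L 0 + d * normalized i L 1)"
  have "regular (projective_space 1) (chart 1 i) (\<lambda>L. ?a L k)" if "k \<le> 1" for k
  proof -
    have "regular (projective_space 1) (chart 1 i) (\<lambda>L. x * normalized i L 0 + y * normalized i L 1)" for x y :: 'a
      by (intro P.regular_add P.regular_mult P.regular_const openin_chart regular_normalized i(1)) simp_all
    moreover have "k = 0 \<or> k = 1" using that by linarith
    ultimately show ?thesis by auto
  qed
  moreover have "?a L \<noteq> (\<lambda>_. 0) \<and> mobius a b c d L = line (?a L)" if L: "L \<in> chart 1 i" for L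
  proof -
    have "normalized i L 0 \<noteq> 0 \<or> normalized i L 1 \<noteq> 0"
      using normalized_nonzero[OF L] normalized_vec2[OF L] vec2_eq_0_iff by metis
    then show ?thesis
      using mobius_nonzero[OF det] mobius_line[of a b c d "normalized i L"] normalized_chart(3)[OF L]
      by (simp add: vec2_eq_0_iff)
  qed
  ultimately show "\<exists>U a'. L \<in> U \<and> openin (zariski (projective_space 1)) U \<and>
      (\<forall>i\<le>1. regular (projective_space 1) U (\<lambda>y. a' y i)) \<and>
      (\<forall>y\<in>U. a' y \<in> coordinate_space (Suc 1) \<and> a' y \<noteq> (\<lambda>_. 0) \<and> mobius a b c d y = line (a' y))"
    using i openin_chart[OF i(1)] vec2_in by (intro exI[of _ "chart 1 i"] exI[of _ ?a]) blast
qed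

lemma isomorphism_mobius:
  assumes "a * d - b * c \<noteq> 0"
  shows "isomorphism (projective_space 1) (projective_space 1) (mobius a b c d)"
proof (rule isomorphismI[OF morphism_mobius[OF assms]])
  have det: "d * a - (- b) * (- c) \<noteq> 0" using assms by (simp add: mult.commute)
  then show "morphism (projective_space 1) (projective_space 1) (mobius d (- b) (- c) a)"
    by (rule morphism_mobius)
  show "mobius d (- b) (- c) a (mobius a b c d L) = L" if "L \<in> points (projective_space 1)" for L
    using that mobius_inverse[OF assms] unfolding points_projective_space by blast
  show "mobius a b c d (mobius d (- b) (- c) a L) = L" if "L \<in> points (projective_space 1)" for L
    using that mobius_inverse[OF det] unfolding points_projective_space by simp
qed

section \<open>Actions of the additive group on the projective line\<close>

lemma vector_group_simps:
  "carrier (vector_group n) = coordinate_space n" "underlying (vector_group n) = affine_space n"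
  "\<one>\<^bsub>vector_group n\<^esub> = (\<lambda>_. 0)" "x \<otimes>\<^bsub>vector_group n\<^esub> y = (\<lambda>i. x i + y i)"
  by (simp_all add: vector_group_def)

text \<open>In the coordinate u / v this is the shift by \<open>t 0\<close>, with the point [1 : 0]
  fixed. It is restricted to the projective line because the elements of \<open>Bij\<close> are
  extensional functions.\<close>

definition translation :: "(nat \<Rightarrow> 'k :: field) \<Rightarrow> (nat \<Rightarrow> 'k) set \<Rightarrow> (nat \<Rightarrow> 'k) set" where
  "translation t = restrict (mobius 1 (t 0) 0 1) (projective_points 1)"

lemma translation_line_vec2:
  "x \<noteq> 0 \<or> y \<noteq> 0 \<Longrightarrow> translation t (line (vec2 x y)) = line (vec2 (x + t 0 * y) y)"
  unfolding translation_def using projective_line_iff by (auto simp: mobius_line_vec2)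

lemma translation_point: "L \<in> projective_points 1 \<Longrightarrow> translation t L \<in> projective_points 1"
  unfolding translation_def using mobius_point[of 1 1 "t 0" 0] by simp

lemma translation_add:
  "L \<in> projective_points 1 \<Longrightarrow> translation s (translation t L) = translation (\<lambda>i. s i + t i) L"
  using translation_point[of L t]
  unfolding translation_def by (simp add: mobius_mobius add.commute)

lemma translation_0: "L \<in> projective_points 1 \<Longrightarrow> translation (\<lambda>_. 0) L = L"
  unfolding translation_def using mobius_scalar[of 1 L] by simp

lemma group_action_translation:
  "group_action (vector_group 1) (points (projective_space 1)) translation"
proof -
  let ?G = "vector_group 1 :: (nat \<Rightarrow> 'a :: alg_closed_field, 'a) algebraic_group"
  interpret linear_algebraic_group ?G by (rule linear_algebraic_group_vector_group)
  have Bij: "translation t \<in> Bij (projective_points 1)" for t :: "nat \<Rightarrow> 'a"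
  proof -
    have "bij_betw (translation t) (projective_points 1) (projective_points 1)"
      by (rule bij_betwI[where g = "translation (\<lambda>i. - t i)"])
        (auto simp: translation_point[simplified] translation_add[simplified] translation_0[simplified])
    then show ?thesis unfolding Bij_def translation_def by simp
  qed
  have "group_hom ?G (BijGroup (projective_points 1)) translation"
  proof (intro group_hom.intro group_hom_axioms.intro group_BijGroup is_group homI)
    fix s t :: "nat \<Rightarrow> 'a"
    show "translation t \<in> carrier (BijGroup (projective_points 1))"
      using Bij by (simp add: BijGroup_def)
    show "translation (s \<otimes>\<^bsub>?G\<^esub> t) =
        translation s \<otimes>\<^bsub>BijGroup (projective_points 1)\<^esub> translation t"
    proof (rule extensionalityI[of _ "projective_points 1"])
      fix L :: "(nat \<Rightarrow> 'a) set" assume "L \<in> projective_points 1"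
      then show "translation (s \<otimes>\<^bsub>?G\<^esub> t) L =
          (translation s \<otimes>\<^bsub>BijGroup (projective_points 1)\<^esub> translation t) L"
        using Bij by (simp only: BijGroup_def vector_group_simps monoid.simps restrict_apply' compose_eq
            translation_add)
    next
      show "translation (s \<otimes>\<^bsub>?G\<^esub> t) \<in> extensional (projective_points 1)"
        unfolding translation_def by (rule restrict_extensional)
      show "translation s \<otimes>\<^bsub>BijGroup (projective_points 1)\<^esub> translation t \<in> extensional (projective_points 1)"
        using Bij by (simp add: BijGroup_def)
    qed
  qed
  then show ?thesis unfolding group_action_def points_projective_space .
qed

text \<open>On each chart of the second factor, [u + t v : v] in normalized coordinates is a regular
  lift to homogeneous coordinates that vanishes nowhere.\<close>

lemma morphism_translation:
  fixes A :: "(nat \<Rightarrow> 'k :: alg_closed_field, 'k) function_space" and P :: "((nat \<Rightarrow> 'k) set, 'k) function_space"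
  defines "A \<equiv> affine_space 1" and "P \<equiv> projective_space 1"
  shows "morphism (product_space A P) P (\<lambda>(t, L). translation t L)"
proof -
  have A: "space_with_functions A" and P: "space_with_functions P"
    unfolding A_def P_def by (rule space_with_functions_affine space_with_functions_projective)+
  interpret AP: space_with_functions "product_space A P" by (rule space_with_functions_product[OF A P])
  note fst = morphism_fst[OF A P] and snd = morphism_snd[OF A P]
  have ptsA: "points A = coordinate_space 1" unfolding A_def by (rule points_affine_space)
  have pts: "points (product_space A P) = coordinate_space 1 \<times> projective_points 1"
    unfolding points_product_space[OF A P] unfolding A_def P_def points_affine_space points_projective_space ..
  show ?thesis
    unfolding P_def
  proof (rule morphism_projective_space[OF AP.space_with_functions_axioms[unfolded P_def]], fold P_def)
    fix p assume p: "p \<in> points (product_space A P)"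
    then have "snd p \<in> projective_points 1" unfolding pts by auto
    then obtain i where i: "i \<le> 1" "snd p \<in> chart 1 i" by (rule chart_cover)
    let ?U = "{p \<in> points (product_space A P). snd p \<in> chart 1 i}"
    let ?n = "\<lambda>p. normalized i (snd p)"
    let ?a = "\<lambda>p. vec2 (?n p 0 + fst p 0 * ?n p 1) (?n p 1)"
    have U: "openin (zariski (product_space A P)) ?U"
      using morphism_open[OF snd] openin_chart[OF i(1)] unfolding P_def by blast
    have n: "regular (product_space A P) ?U (\<lambda>p. ?n p k)" if "k \<le> 1" for k
      using morphism_regular[OF snd] regular_normalized[OF i(1) that] unfolding P_def by blast
    have "regular A (points A) (\<lambda>x. x 0)"
      unfolding A_def by (rule regular_affine_polynomial[OF polynomial_function_coordinate]) auto
    then have "regular (product_space A P) ?U (\<lambda>p. fst p 0)"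
      by (rule AP.regular_subset[OF morphism_regular[OF fst] U])
        (auto simp: pts ptsA)
    then have reg: "regular (product_space A P) ?U (\<lambda>p. ?n p 0 + fst p 0 * ?n p 1)"
      by (intro AP.regular_add AP.regular_mult n) simp_all
    have "regular (product_space A P) ?U (\<lambda>p. ?a p k)" if "k \<le> 1" for k
    proof -
      have "k = 0 \<or> k = 1" using that by linarith
      then show ?thesis using reg n[of 1] by auto
    qed
    moreover have "?a q \<noteq> (\<lambda>_. 0) \<and> (case q of (t, L) \<Rightarrow> translation t L) = line (?a q)" if q: "q \<in> ?U" for q
    proof -
      obtain t L where tL: "q = (t, L)" by (cases q)
      have L: "L \<in> chart 1 i" using q tL by simp
      have nz: "normalized i L 0 \<noteq> 0 \<or> normalized i L 1 \<noteq> 0"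
        using normalized_nonzero[OF L] normalized_vec2[OF L] vec2_eq_0_iff by metis
      have "translation t L = translation t (line (vec2 (normalized i L 0) (normalized i L 1)))"
        using normalized_vec2[OF L] normalized_chart(3)[OF L] by simp
      with nz show ?thesis unfolding tL by (auto simp: translation_line_vec2 vec2_eq_0_iff)
    qed
    ultimately show "\<exists>U a. p \<in> U \<and> openin (zariski (product_space A P)) U \<and>
        (\<forall>i\<le>1. regular (product_space A P) U (\<lambda>y. a y i)) \<and>
        (\<forall>y\<in>U. a y \<in> coordinate_space (Suc 1) \<and> a y \<noteq> (\<lambda>_. 0) \<and>
           (case y of (t, L) \<Rightarrow> translation t L) = line (a y))"
      using U p i(2) vec2_in by (intro exI[of _ ?U] exI[of _ ?a]) blast
  qed
qed

lemma chart_1_1E: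
  assumes "L \<in> chart 1 1" obtains u where "L = line (vec2 u 1)"
  using normalized_vec2[OF assms] normalized_chart(2,3)[OF assms] that by metis

text \<open>The generic points are those of \<open>chart 1 1\<close>, the complement of the fixed
  point [1 : 0]. Translation is simply transitive there, so stabilizers are trivial and each orbit
  contains the chart, which is dense by irreducibility.\<close>

lemma G_variety_translation:
  "G_variety (vector_group 1 :: (nat \<Rightarrow> 'k :: alg_closed_field, 'k) algebraic_group) (projective_space 1) translation"
proof -
  let ?G = "vector_group 1 :: (nat \<Rightarrow> 'k, 'k) algebraic_group"
  let ?P = "projective_space 1 :: ((nat \<Rightarrow> 'k) set, 'k) function_space"
  have U: "openin (zariski ?P) (chart 1 1)" by (rule openin_chart) simp
  have mem: "line (vec2 u 1) \<in> chart 1 1" for u :: 'k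
    using line_mem_chart_iff[OF vec2_in, of u 1 1] vec2_eq_0_iff[of u 1] by simp
  then have ne: "chart 1 1 \<noteq> ({} :: (nat \<Rightarrow> 'k) set set)" by blast
  have tr: "translation t (line (vec2 u 1)) = line (vec2 (u + t 0) 1)" for t and u :: 'k
    by (simp add: translation_line_vec2)
  have "stabilizer ?G translation L = {\<one>\<^bsub>?G\<^esub>}" if L: "L \<in> chart 1 1" for L
  proof -
    obtain u where u: "L = line (vec2 u 1)" using L by (rule chart_1_1E)
    have fixes_0: "t 0 = 0" if "translation t L = L" for t
      using that line_vec2_eqD[of "u + t 0" 1 u 1] unfolding u tr by simp
    have "t = (\<lambda>_. 0)" if "t \<in> coordinate_space 1" "translation t L = L" for t
    proof -
      have "affine_point (t 0) = (\<lambda>_. 0)" using fixes_0[OF that(2)] by (simp add: affine_point_def)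
      then show ?thesis using affine_point_eq[OF that(1)] by simp
    qed
    moreover have "translation (\<lambda>_. 0) L = L" unfolding u tr by simp
    ultimately show ?thesis
      unfolding stabilizer_def vector_group_simps by (auto simp: coordinate_space_def)
  qed
  then have stab: "generically ?P (\<lambda>L. stabilizer ?G translation L = {\<one>\<^bsub>?G\<^esub>})"
    unfolding generically_def using U ne by blast
  have "zariski ?P closure_of orbit ?G translation L = points ?P" if L: "L \<in> chart 1 1" for L
  proof -
    obtain u where u: "L = line (vec2 u 1)" using L by (rule chart_1_1E)
    have "chart 1 1 \<subseteq> orbit ?G translation L"
    proof
      fix M :: "(nat \<Rightarrow> 'k) set" assume "M \<in> chart 1 1"
      then obtain w where "M = line (vec2 w 1)" by (rule chart_1_1E)
      then have "M = translation (affine_point (w - u)) L" unfolding u tr by simp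
      then show "M \<in> orbit ?G translation L"
        unfolding orbit_def vector_group_simps using affine_point_in by blast
    qed
    moreover have "orbit ?G translation L \<inter> V \<noteq> {}"
      if "openin (zariski ?P) V" "V \<noteq> {}" for V
      using projective_space_irreducible[OF U ne that] calculation by blast
    ultimately show ?thesis
      unfolding closure_of_def by (auto simp: Int_commute)
  qed
  then have dense: "generically ?P (\<lambda>L. zariski ?P closure_of orbit ?G translation L = points ?P)"
    unfolding generically_def using U ne by blast
  show ?thesis
    unfolding G_variety_def vector_group_simps(2)
    by (intro conjI linear_algebraic_group_vector_group variety_projective_space
        group_action_translation connected_affine_space morphism_translation stab dense)
qed

section \<open>Uniqueness: normal form of an arbitrary structure\<close>

lemma orbit_morphism:
  assumes "space_with_functions G" "space_with_functions S"
    and "morphism (product_space G S) S (\<lambda>(g, x). \<phi> g x)" "x \<in> points S"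
  shows "morphism G S (\<lambda>g. \<phi> g x)"
proof -
  interpret G: space_with_functions G by fact
  have "morphism G (product_space G S) (\<lambda>g. (g, x))"
    by (rule morphism_pair[OF assms(1,2,1) G.morphism_id morphism_const[OF assms(1,2,4)]])
  from morphism_comp[OF this assms(3)] show ?thesis by (simp add: comp_def)
qed

lemma G_variety_conjugate_translation:
  fixes \<phi> :: "(nat \<Rightarrow> 'k :: {alg_closed_field, field_char_0}) \<Rightarrow> (nat \<Rightarrow> 'k) set \<Rightarrow> (nat \<Rightarrow> 'k) set"
  assumes \<phi>: "G_variety (vector_group 1) (projective_space 1) \<phi>"
  shows "\<exists>a b c d. a * d - b * c \<noteq> 0 \<and> (\<forall>t\<in>coordinate_space 1. \<forall>L\<in>projective_points 1.
    \<phi> t (mobius a b c d L) = mobius a b c d (translation t L))"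
proof -
  let ?G = "vector_group 1 :: (nat \<Rightarrow> 'k, 'k) algebraic_group"
  let ?A = "affine_space 1 :: (nat \<Rightarrow> 'k, 'k) function_space"
  let ?P = "projective_space 1 :: ((nat \<Rightarrow> 'k) set, 'k) function_space"
  have act: "group_action ?G (projective_points 1) \<phi>"
    and mor: "morphism (product_space ?A ?P) ?P (\<lambda>(t, L). \<phi> t L)"
    and stab: "generically ?P (\<lambda>x. stabilizer ?G \<phi> x = {\<one>\<^bsub>?G\<^esub>})"
    using \<phi> unfolding G_variety_def points_projective_space vector_group_simps(2) by blast+
  interpret group_action ?G "projective_points 1" \<phi> by (rule act)
  have comp: "\<phi> (affine_point s) (\<phi> (affine_point t) L) = \<phi> (affine_point (s + t)) L"
    if "L \<in> projective_points 1" for s t L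
  proof -
    have "affine_point s \<otimes>\<^bsub>?G\<^esub> affine_point t = affine_point (s + t)"
      unfolding vector_group_simps by (auto simp: affine_point_def)
    then show ?thesis
      using composition_rule[OF that, unfolded vector_group_simps(1), OF affine_point_in affine_point_in, of s t]
      by simp
  qed
  have one: "\<phi> (affine_point 0) L = L" if "L \<in> projective_points 1" for L
  proof -
    have "affine_point 0 = \<one>\<^bsub>?G\<^esub>" unfolding vector_group_simps by (auto simp: affine_point_def)
    then show ?thesis using id_eq_one that by (metis restrict_apply')
  qed
  have closed: "\<phi> (affine_point t) L \<in> projective_points 1" if "L \<in> projective_points 1" for t L
    using element_image[unfolded vector_group_simps(1), OF affine_point_in that refl] .
  obtain x where x: "x \<in> projective_points 1" "stabilizer ?G \<phi> x = {\<one>\<^bsub>?G\<^esub>}"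
    using stab openin_subset[of "zariski ?P"] unfolding generically_def points_projective_space by blast
  \<comment> \<open>If two orbit points coincide, the difference of their parameters lies in the
    stabilizer of \<open>x\<close>.\<close>
  have inj: "s = t" if eq: "\<phi> (affine_point s) x = \<phi> (affine_point t) x" for s t
  proof -
    have "\<phi> (affine_point (- t + s)) x = x"
      using comp[OF x(1), of "- t" s] comp[OF x(1), of "- t" t] one[OF x(1)] eq by simp
    then have "affine_point (- t + s) \<in> stabilizer ?G \<phi> x"
      unfolding stabilizer_def vector_group_simps using affine_point_in by blast
    then have "affine_point (- t + s) = (\<lambda>_. 0)" unfolding x(2) vector_group_simps by simp
    then have "- t + s = 0" by (metis affine_point_0)
    then show "s = t" by (simp add: add_eq_0_iff)
  qed
  have "morphism ?A ?P (\<lambda>t. \<phi> t x)"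
    by (rule orbit_morphism[OF space_with_functions_affine space_with_functions_projective mor])
      (use x(1) in \<open>simp only: points_projective_space\<close>)
  then obtain p q where pq: "\<And>t. poly p t \<noteq> 0 \<or> poly q t \<noteq> 0"
    "\<And>t. \<phi> (affine_point t) x = line (vec2 (poly p t) (poly q t))"
    by (rule morphism_affine_line_projective_line) blast
  have inj': "s = t" if "poly p s * poly q t = poly p t * poly q s" for s t
    by (rule inj, unfold pq(2), rule line_vec2_eqI[OF that pq(1) pq(1)])
  have deg: "Polynomial.degree p \<le> 1" "Polynomial.degree q \<le> 1"
    using injective_quotient_degree_le_1[of p q] pq(1) inj' by blast+
  have linear: "poly r t = Polynomial.coeff r 1 * t + Polynomial.coeff r 0"
    if "Polynomial.degree r \<le> 1" for r :: "'k poly" and t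
  proof -
    have "poly r t = (\<Sum>i\<le>1. Polynomial.coeff r i * t ^ i)"
      unfolding poly_altdef by (rule sum.mono_neutral_left) (use that in \<open>auto intro: coeff_eq_0\<close>)
    then show ?thesis by simp
  qed
  define a b c d where "a = Polynomial.coeff p 1" and "b = Polynomial.coeff p 0"
    and "c = Polynomial.coeff q 1" and "d = Polynomial.coeff q 0"
  have p: "poly p t = a * t + b" and q: "poly q t = c * t + d" for t
    unfolding a_def b_def c_def d_def by (rule linear[OF deg(1)] linear[OF deg(2)])+
  \<comment> \<open>The determinant is the cross product of the homogeneous coordinates of the orbit
    points at parameters 1 and 0; if it vanished, these two points would coincide.\<close>
  have det: "a * d - b * c \<noteq> 0"
  proof
    assume "a * d - b * c = 0"
    moreover have "poly p 1 * poly q 0 - poly p 0 * poly q 1 = a * d - b * c"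
      unfolding p q by (simp add: algebra_simps)
    ultimately have "(1 :: 'k) = 0" using inj'[of 1 0] by simp
    then show False by simp
  qed
  let ?m = "mobius a b c d"
  have orbit: "\<phi> (affine_point t) x = ?m (line (vec2 t 1))" for t
    unfolding pq(2) p q mobius_line_vec2 by simp
  \<comment> \<open>The images of the points [s : 1] are the orbit points, where the action is
    addition of parameters.\<close>
  have finite_point: "\<phi> (affine_point t) (?m (line (vec2 s 1))) = ?m (translation (affine_point t) (line (vec2 s 1)))"
    for s t
    unfolding orbit[symmetric] comp[OF x(1)] unfolding orbit
    by (simp add: translation_line_vec2 add.commute)
  have P_cases: "(\<exists>s. L = line (vec2 s 1)) \<or> L = line (vec2 1 0)"
    if L: "L \<in> projective_points 1" for L :: "(nat \<Rightarrow> 'k) set"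
  proof -
    obtain u v where uv: "u \<noteq> 0 \<or> v \<noteq> 0" "L = line (vec2 u v)" using L by (rule projective_lineE)
    show ?thesis
    proof (cases "v = 0")
      case True
      then show ?thesis using uv line_vec2_scale[of u 1 0] by simp
    next
      case False
      then show ?thesis using uv line_vec2_scale[of v "u / v" 1] by auto
    qed
  qed
  define infty where "infty = line (vec2 (1 :: 'k) 0)"
  have infty: "infty \<in> projective_points 1"
    unfolding infty_def projective_line_iff by (intro exI[of _ 1] exI[of _ 0]) simp
  have m_infty: "?m infty \<in> projective_points 1" by (rule mobius_point[OF det infty])
  have infty_not_orbit: "?m infty \<noteq> \<phi> (affine_point s) x" for s
  proof
    assume "?m infty = \<phi> (affine_point s) x"
    then have "infty = line (vec2 s 1)"
      unfolding orbit using mobius_inverse[OF det] infty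
      by (metis projective_line_iff zero_neq_one)
    then show False using line_vec2_eqD[of 1 0 s 1] unfolding infty_def by simp
  qed
  \<comment> \<open>All other points belong to the orbit, so an element moving this point would
    carry it into the orbit. Acting by the inverse element would then place the point itself in the
    orbit.\<close>
  have infinite_point: "\<phi> (affine_point t) (?m infty) = ?m infty" for t
  proof (rule ccontr)
    assume ne: "\<phi> (affine_point t) (?m infty) \<noteq> ?m infty"
    let ?y = "\<phi> (affine_point t) (?m infty)"
    let ?m' = "mobius d (- b) (- c) a"
    have y: "?y \<in> projective_points 1" by (rule closed[OF m_infty])
    have det': "d * a - (- b) * (- c) \<noteq> 0" using det by (simp add: mult.commute)
    have m'y: "?m (?m' ?y) = ?y" using mobius_inverse[OF det' y] by simp
    with ne have "?m' ?y \<noteq> infty" by auto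
    then obtain s where "?m' ?y = line (vec2 s 1)"
      using P_cases[OF mobius_point[OF det' y]] unfolding infty_def by blast
    then have "?y = \<phi> (affine_point s) x" using m'y orbit by simp
    then have "?m infty = \<phi> (affine_point (- t + s)) x"
      using comp[OF m_infty, of "- t" t] comp[OF x(1), of "- t" s] one[OF m_infty] by simp
    then show False using infty_not_orbit by blast
  qed
  show ?thesis
  proof (intro exI conjI ballI)
    fix t :: "nat \<Rightarrow> 'k" and L :: "(nat \<Rightarrow> 'k) set"
    assume t: "t \<in> coordinate_space 1" and L: "L \<in> projective_points 1"
    have t': "t = affine_point (t 0)" using affine_point_eq[OF t] by simp
    have "translation t infty = infty" unfolding infty_def by (simp add: translation_line_vec2)
    then show "\<phi> t (?m L) = ?m (translation t L)"
      using P_cases[OF L] finite_point[of "t 0"] infinite_point[of "t 0"] t' unfolding infty_def by auto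
  qed (rule det)
qed

lemma G_variety_projective_line_unique:
  fixes \<phi>\<^sub>1 \<phi>\<^sub>2 :: "(nat \<Rightarrow> 'k :: {alg_closed_field, field_char_0}) \<Rightarrow> (nat \<Rightarrow> 'k) set \<Rightarrow> (nat \<Rightarrow> 'k) set"
  assumes "G_variety (vector_group 1) (projective_space 1) \<phi>\<^sub>1" "G_variety (vector_group 1) (projective_space 1) \<phi>\<^sub>2"
  shows "equivalent_G_varieties (vector_group 1) (projective_space 1) \<phi>\<^sub>1 (projective_space 1) \<phi>\<^sub>2"
proof -
  obtain a b c d where m: "a * d - b * c \<noteq> 0"
    and conj1: "\<forall>t\<in>coordinate_space 1. \<forall>L\<in>projective_points 1.
      \<phi>\<^sub>1 t (mobius a b c d L) = mobius a b c d (translation t L)"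
    using G_variety_conjugate_translation[OF assms(1)] by blast
  obtain a' b' c' d' where m': "a' * d' - b' * c' \<noteq> 0"
    and conj2: "\<forall>t\<in>coordinate_space 1. \<forall>L\<in>projective_points 1.
      \<phi>\<^sub>2 t (mobius a' b' c' d' L) = mobius a' b' c' d' (translation t L)"
    using G_variety_conjugate_translation[OF assms(2)] by blast
  have inv: "d * a - (- b) * (- c) \<noteq> 0" using m by (simp add: mult.commute)
  \<comment> \<open>The adjugate of the first matrix turns \<open>\<phi>\<^sub>1\<close> into the
    translations, and the second matrix turns these into \<open>\<phi>\<^sub>2\<close>.\<close>
  let ?j = "mobius a' b' c' d' \<circ> mobius d (- b) (- c) a"
  have "isomorphism (projective_space 1) (projective_space 1) ?j"
    by (rule isomorphism_comp[OF isomorphism_mobius[OF inv] isomorphism_mobius[OF m']])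
  moreover have "algebraic_automorphism (vector_group 1 :: (nat \<Rightarrow> 'k, 'k) algebraic_group) (\<lambda>t. t)"
  proof -
    interpret A: space_with_functions "affine_space 1 :: (nat \<Rightarrow> 'k, 'k) function_space"
      by (rule space_with_functions_affine)
    show ?thesis unfolding algebraic_automorphism_def vector_group_simps(2)
      by (intro conjI iso_set_refl isomorphismI[OF A.morphism_id A.morphism_id] refl)
  qed
  moreover have "?j (\<phi>\<^sub>1 t L) = \<phi>\<^sub>2 t (?j L)"
    if t: "t \<in> coordinate_space 1" and L: "L \<in> projective_points 1" for t L
  proof -
    define M where "M = mobius d (- b) (- c) a L"
    have M: "M \<in> projective_points 1" unfolding M_def by (rule mobius_point[OF inv L])
    have L': "L = mobius a b c d M" unfolding M_def using mobius_inverse[OF inv L] by simp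
    have "?j (\<phi>\<^sub>1 t L) = mobius a' b' c' d' (translation t M)"
      unfolding L' conj1[rule_format, OF t M] using mobius_inverse[OF m translation_point[OF M]] by simp
    also have "\<dots> = \<phi>\<^sub>2 t (mobius a' b' c' d' M)" using conj2[rule_format, OF t M] by simp
    also have "\<dots> = \<phi>\<^sub>2 t (?j L)" unfolding M_def by simp
    finally show ?thesis .
  qed
  ultimately show ?thesis
    unfolding equivalent_G_varieties_def vector_group_simps(1) points_projective_space by blast
qed

theorem proposition3p1:
  shows "(\<exists>\<phi>. G_variety (vector_group 1 :: (nat \<Rightarrow> Qbar, Qbar) algebraic_group) (projective_space 1) \<phi>) \<and>
    (\<forall>\<phi>\<^sub>1 \<phi>\<^sub>2.
       G_variety (vector_group 1 :: (nat \<Rightarrow> Qbar, Qbar) algebraic_group) (projective_space 1) \<phi>\<^sub>1 \<and>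
       G_variety (vector_group 1 :: (nat \<Rightarrow> Qbar, Qbar) algebraic_group) (projective_space 1) \<phi>\<^sub>2 \<longrightarrow>
       equivalent_G_varieties (vector_group 1 :: (nat \<Rightarrow> Qbar, Qbar) algebraic_group)
         (projective_space 1) \<phi>\<^sub>1 (projective_space 1) \<phi>\<^sub>2)"
  using G_variety_translation G_variety_projective_line_unique by blast

end
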